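(* Let $L$ be a countable non-scattered linear order. Let $\preceq_L$ be the quasi-order on ${}^L\omega$ defined by $c\preceq_Lc'$ iff there is an order embedding $g\colon L\to L$ with $c(x)=c'(g(x))$ for all $x\in L$, and let $\cong_L$ be given by $c\cong_Lc'$ iff there is an order automorphism $h$ of $L$ with $c(x)=c'(h(x))$ for all $x$. Then the pair $(\preceq_L,\cong_L)$ is invariantly universal.
   Context: A linear order is non-scattered if it contains a suborder isomorphic to $(\mathbb Q,<)$. Borel reducibility: for binary relations $R,R'$ on standard Borel spaces $X,X'$, a Borel $h\colon X\to X'$ with $x\,R\,y \iff h(x)\,R'\,h(y)$ is a Borel reduction, written $R\le_B R'$; $R\sim_B R'$ means $R\le_B R'\le_B R$. For an analytic quasi-order $S$ on a standard Borel space $X$ and an analytic equivalence relation $E\subseteq S\cap S^{-1}$ on $X$, the pair $(S,E)$ is invariantly universal if for every analytic quasi-order $R$ on a standard Borel space there is a Borel $E$-invariant $B\subseteq X$ with $R\sim_B S\restriction B$. *)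

theory Defs
  imports "HOL-Analysis.Analysis"
begin

text \<open>
  The type \<^typ>\<open>'a measure\<close> is used only for its underlying measurable space
  (\<^const>\<open>space\<close> and \<^const>\<open>sets\<close>); the measure it carries plays no role.
\<close>

definition standard_borel :: "'a measure \<Rightarrow> bool" where
  "standard_borel M \<longleftrightarrow>
     (\<exists>T. separable_space T \<and> completely_metrizable_space T \<and>
          topspace T = space M \<and> sets M = sigma_sets (space M) {U. openin T U})"

text \<open>
  Analytic subsets of a standard Borel space \<open>M\<close> are the projections of Borel subsets of
  the product of \<open>M\<close> with the Baire space \<^typ>\<open>nat \<Rightarrow> nat\<close>.
\<close>

definition analytic_set :: "'a measure \<Rightarrow> 'a set \<Rightarrow> bool" where
  "analytic_set M A \<longleftrightarrow>
     (\<exists>B \<in> sets (M \<Otimes>\<^sub>M (borel :: (nat \<Rightarrow> nat) measure)). A = fst ` B)"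

definition analytic_quasi_order :: "'a measure \<Rightarrow> 'a rel \<Rightarrow> bool" where
  "analytic_quasi_order M R \<longleftrightarrow> preorder_on (space M) R \<and> analytic_set (M \<Otimes>\<^sub>M M) R"

definition analytic_equiv :: "'a measure \<Rightarrow> 'a rel \<Rightarrow> bool" where
  "analytic_equiv M E \<longleftrightarrow> equiv (space M) E \<and> analytic_set (M \<Otimes>\<^sub>M M) E"

definition borel_reducible :: "'a measure \<Rightarrow> 'a rel \<Rightarrow> 'b measure \<Rightarrow> 'b rel \<Rightarrow> bool" where
  "borel_reducible M R N S \<longleftrightarrow>
     (\<exists>h \<in> measurable M N. \<forall>x \<in> space M. \<forall>y \<in> space M. (x, y) \<in> R \<longleftrightarrow> (h x, h y) \<in> S)"

definition borel_bireducible :: "'a measure \<Rightarrow> 'a rel \<Rightarrow> 'b measure \<Rightarrow> 'b rel \<Rightarrow> bool" where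
  "borel_bireducible M R N S \<longleftrightarrow> borel_reducible M R N S \<and> borel_reducible N S M R"

text \<open>
  HOL cannot quantify over types inside a formula, so the type carrying the arbitrary
  standard Borel space is a parameter; in a theorem it is a type variable, and hence
  universally quantified. The standing requirements on the pair \<open>(S, E)\<close> are part of
  the definition. The restriction of \<open>S\<close> to \<open>B\<close> lives on the standard Borel space
  \<open>restrict_space M B\<close>.
\<close>

definition invariantly_universal :: "'b itself \<Rightarrow> 'a measure \<Rightarrow> 'a rel \<Rightarrow> 'a rel \<Rightarrow> bool" where
  "invariantly_universal (_ :: 'b itself) M S E \<longleftrightarrow>
     standard_borel M \<and> analytic_quasi_order M S \<and> analytic_equiv M E \<and> E \<subseteq> S \<inter> S\<inverse> \<and>
     (\<forall>(N :: 'b measure) R. standard_borel N \<and> analytic_quasi_order N R \<longrightarrow>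
        (\<exists>B \<in> sets M. E `` B \<subseteq> B \<and>
           borel_bireducible N R (restrict_space M B) (S \<inter> B \<times> B)))"

definition non_scattered :: "'l::linorder itself \<Rightarrow> bool" where
  "non_scattered (_ :: 'l itself) \<longleftrightarrow> (\<exists>f :: rat \<Rightarrow> 'l. strict_mono f)"

text \<open>
  The linear order is the type \<open>'l\<close>. The space of colourings \<^typ>\<open>'l \<Rightarrow> nat\<close> carries the
  product topology with \<^typ>\<open>nat\<close> discrete, and \<^const>\<open>borel\<close> is its Borel structure.
  Between linear orders, order embeddings are the strictly increasing maps and
  automorphisms the strictly increasing bijections.
\<close>

definition col_embed :: "('l::linorder \<Rightarrow> nat) rel" where
  "col_embed = {(c, c'). \<exists>g :: 'l \<Rightarrow> 'l. strict_mono g \<and> (\<forall>x. c x = c' (g x))}"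

definition col_iso :: "('l::linorder \<Rightarrow> nat) rel" where
  "col_iso = {(c, c'). \<exists>h :: 'l \<Rightarrow> 'l. bij h \<and> strict_mono h \<and> (\<forall>x. c x = c' (h x))}"

end

theory Submission
  imports Defs
begin

text \<open>
  Let \<open>R\<close> be an analytic quasi-order, coded on the Cantor space as the projection of
  a closed set. Following Louveau and Rosendal, one attaches to each point \<open>a\<close> a set
  \<open>P a\<close> of finite sequences, made of approximations to witnesses of \<open>b R
  a\<close>, such that \<open>a R b\<close> with witness \<open>f\<close> implies that adding
  \<open>f + 2\<close> digitwise maps \<open>P a\<close> into \<open>P b\<close>, while convergent
  branches of \<open>P b\<close> through the prefixes of \<open>a\<close> yield \<open>a R
  b\<close>.

  The sequences are ordered lexicographically with reversed digits. Adding a fixed sequence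
  preserves this order, and every increasing sequence of nodes of lengths \<open>0, 1, 2,
  \<dots>\<close> converges. As \<open>L\<close> is not scattered, it maps monotonically onto this
  order with a top element added, with non-scattered fibres. Each fibre (block) has a marked
  point, whose colour tells whether the node belongs to \<open>P a\<close>; the other points get
  fresh colours, except for copies of the blocks of all digitwise smaller nodes, which make the
  addition maps lift to colour preserving embeddings.

  All colour classes are reversely well-ordered, so a colouring isomorphic to one in the image of
  the reduction is so by a unique isomorphism, which depends on it in a Borel way. Hence
  \<open>a\<close> can be decoded, and the saturation of the image is Borel.
\<close>

section \<open>Standard Borel spaces and Suslin sets\<close>

text \<open>No formula turns witnesses of \<open>a R b\<close> and \<open>b R c\<close> into one of
  \<open>a R c\<close>, so a set built from single witnesses would not be carried along by adding
  digits. Hence \<open>P a\<close> is built from chains of steps, whose length is charged to the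
  first digit: composing two chains adds these digits and costs one more. Together with the strict
  bound on witness digits this gives the constant 2. Chains do no harm in the limit, since
  \<open>R\<close> is transitive.

  Reversing the digits serves both halves of the argument. Above a stable prefix an increase lowers
  a natural number, so branches converge; and the nodes of one length are reversely well-ordered,
  which passes to the colour classes.

  The colourings need many embeddings between them and no nontrivial automorphisms. Copies reconcile
  the two demands: they are laid out once and for all, independently of \<open>a\<close>, which
  enters only through one bit at each marked point.\<close>

instantiation nat :: metric_space
begin

definition dist_nat :: "nat \<Rightarrow> nat \<Rightarrow> real" where
  "dist_nat m n = (if m = n then 0 else 1)"

definition uniformity_nat :: "(nat \<times> nat) filter" where
  "uniformity_nat = (INF e\<in>{0 <..}. principal {(x, y). dist x y < e})"

instance
proof
  show "open U \<longleftrightarrow> (\<forall>x\<in>U. \<forall>\<^sub>F (x', y) in uniformity. x' = x \<longrightarrow> y \<in> U)" for U :: "nat set"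
  proof -
    have "uniformity \<le> principal {(x, y :: nat). dist x y < 1}"
      unfolding uniformity_nat_def by (rule INF_lower) simp
    then have "\<forall>\<^sub>F (x', y) in uniformity. (x' :: nat) = y"
      by (rule filter_leD) (auto simp: eventually_principal dist_nat_def split: if_splits)
    then have "\<forall>x\<in>U. \<forall>\<^sub>F (x', y) in uniformity. x' = x \<longrightarrow> y \<in> U"
      by (auto elim!: eventually_mono)
    then show ?thesis by (simp add: open_discrete)
  qed
qed (auto simp: uniformity_nat_def dist_nat_def)

end

text \<open>Countable products of Polish spaces are Polish, so \<open>nat \<Rightarrow> nat\<close>
  and the space of colourings become Polish metric spaces.\<close>

instance nat :: polish_space
proof
  fix X :: "nat \<Rightarrow> nat" assume "Cauchy X"
  then obtain M where M: "\<And>n. n \<ge> M \<Longrightarrow> dist (X n) (X M) < 1"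
    unfolding Cauchy_def by (meson order_refl zero_less_one)
  have "X n = X M" if "n \<ge> M" for n using M[OF that] by (simp add: dist_nat_def split: if_splits)
  then have "\<forall>\<^sub>F n in sequentially. X n = X M" unfolding eventually_sequentially by blast
  then have "X \<longlonglongrightarrow> X M" by (rule tendsto_eventually)
  then show "convergent X" by (rule convergentI)
qed

text \<open>\<open>\<phi> x\<close> records, for every point of a dense sequence and every
  \<open>k\<close>, whether it lies within \<open>(1/2)^k\<close> of \<open>x\<close>;
  \<open>\<psi>\<close> recovers \<open>x\<close> as a limit of recorded points. Having
  \<open>\<psi>\<close> on a Borel set \<open>D\<close> makes the image of \<open>\<phi>\<close>
  Borel later, as the set of \<open>z\<close> in \<open>D\<close> with
  \<open>\<phi> (\<psi> z) = z\<close>.\<close>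

lemma countable_section_standard_borel:
  assumes "standard_borel N"
  obtains \<phi> :: "'b \<Rightarrow> nat \<Rightarrow> nat" and \<psi> D where
    "\<phi> \<in> measurable N borel" "\<And>x i. \<phi> x i < 2"
    "D \<in> sets borel" "\<psi> \<in> measurable (restrict_space borel D) N"
    "\<And>x. x \<in> space N \<Longrightarrow> \<phi> x \<in> D" "\<And>x. x \<in> space N \<Longrightarrow> \<psi> (\<phi> x) = x"
proof -
  obtain T where T: "separable_space T" "completely_metrizable_space T" "topspace T = space N"
    and sN: "sets N = sigma_sets (space N) {U. openin T U}"
    using assms unfolding standard_borel_def by blast
  obtain M d where Md: "Metric_space M d" "Metric_space.mcomplete M d" "T = Metric_space.mtopology M d"
    using T(2) unfolding completely_metrizable_space_def by blast
  interpret Metric_space M d by fact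
  have M: "M = space N" using T(3) Md(3) by simp
  have op: "openin mtopology U \<Longrightarrow> U \<in> sets N" for U
    using sN Md(3) by (auto intro: sigma_sets.Basic)
  show thesis
  proof (cases "M = {}")
    case True
    show thesis
    proof (rule that[of "\<lambda>_ _. 0" "{}" "\<lambda>_. undefined"])
      show "(\<lambda>_. undefined) \<in> restrict_space borel {} \<rightarrow>\<^sub>M N"
        by (rule measurableI) (auto simp: space_restrict_space sets_restrict_space)
    qed (use True M in auto)
  next
    case False
    obtain C where C: "countable C" "C \<subseteq> M" "T closure_of C = M"
      using T(1) T(3) M unfolding separable_space_def by auto
    have Cne: "C \<noteq> {}" using C False by auto
    define a where "a = from_nat_into C"
    have aM: "a n \<in> M" for n using from_nat_into[OF Cne] C(2) a_def by auto
    have dense: "\<exists>n. d x (a n) < r" if "x \<in> M" "r > 0" for x r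
    proof -
      have "x \<in> mtopology closure_of C" using that C(3) Md(3) by simp
      then obtain y where "y \<in> C" "y \<in> mball x r" using \<open>r > 0\<close> unfolding metric_closure_of in_mball mem_Collect_eq by blast
      then show ?thesis using C(1) a_def by (metis from_nat_into_surj in_mball)
    qed
    define \<phi> where "\<phi> x i = (if d x (a (fst (prod_decode i))) < (1/2)^(snd (prod_decode i)) then 1 else 0 :: nat)" for x i
    define m where "m z k = (LEAST n. z (prod_encode (n,k)) = (1::nat))" for z k
    \<comment> \<open>\<open>D\<close> keeps only what makes the recorded points Cauchy at a
      geometric rate. For a code of \<open>x\<close>, consecutive points are within
      \<open>(1/2)^k\<close> and \<open>(1/2)^Suc k\<close> of \<open>x\<close>, which the bound
      \<open>2 * (1/2)^k\<close> covers.\<close>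
    define D where "D = {z. (\<forall>k. \<exists>n. z (prod_encode (n,k)) = 1) \<and> 
       (\<forall>k. d (a (m z k)) (a (m z (Suc k))) \<le> 2 * (1/2)^k)}"
    have \<phi>m: "\<phi> x (prod_encode (n,k)) = 1 \<longleftrightarrow> d x (a n) < (1/2)^k" for x n k
      by (simp add: \<phi>_def)
    have \<phi>D: "d x (a (m (\<phi> x) k)) < (1/2)^k" if "x \<in> M" for x k
    proof -
      have "\<exists>n. \<phi> x (prod_encode (n,k)) = 1" using dense[OF that, of "(1/2)^k"] \<phi>m by auto
      then have "\<phi> x (prod_encode (m (\<phi> x) k, k)) = 1" unfolding m_def by (rule LeastI_ex)
      then show ?thesis using \<phi>m by simp
    qed
    have \<phi>inD: "\<phi> x \<in> D" if "x \<in> M" for x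
    proof -
      have "d (a (m (\<phi> x) k)) (a (m (\<phi> x) (Suc k))) \<le> 2 * (1/2)^k" for k
      proof -
        have "d (a (m (\<phi> x) k)) (a (m (\<phi> x) (Suc k))) \<le> d x (a (m (\<phi> x) k)) + d x (a (m (\<phi> x) (Suc k)))"
          using triangle[OF aM that aM] by (simp add: commute)
        also have "\<dots> \<le> (1/2)^k + (1/2)^Suc k" using \<phi>D[OF that] by (smt (verit))
        also have "\<dots> \<le> 2 * (1/2)^k" by simp
        finally show ?thesis .
      qed
      moreover have "\<exists>n. \<phi> x (prod_encode (n,k)) = 1" for k using dense[OF that, of "(1/2)^k"] \<phi>m by auto
      ultimately show ?thesis unfolding D_def by auto
    qed
    \<comment> \<open>The bound is the exact sum of the steps \<open>2 * (1/2)^i\<close> for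
      \<open>i\<close> from \<open>k\<close> to \<open>k + j - 1\<close>, so that the induction
      closes.\<close>
    have near: "d (a (m z k)) (a (m z (k + j))) \<le> 4 * (1/2)^k - 4 * (1/2)^(k+j)" if "z \<in> D" for z k j
    proof (induction j)
      case (Suc j)
      have "d (a (m z k)) (a (m z (k + Suc j))) \<le> d (a (m z k)) (a (m z (k + j))) + d (a (m z (k+j))) (a (m z (Suc (k+j))))"
        using triangle[OF aM aM aM] by simp
      also have "\<dots> \<le> 4 * (1/2)^k - 4 * (1/2)^(k+j) + 2 * (1/2)^(k+j)"
        using Suc that unfolding D_def by (smt (verit) mem_Collect_eq)
      finally show ?case by (simp add: power_add)
    qed (simp add: aM)
    have near': "d (a (m z k)) (a (m z n)) \<le> 4 * (1/2)^k" if "z \<in> D" "k \<le> n" for z k n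
    proof -
      have "0 \<le> 4 * (1/2::real)^n" by simp
      moreover have "d (a (m z k)) (a (m z n)) \<le> 4 * (1/2)^k - 4 * (1/2)^n"
        using near[OF that(1), of k "n-k"] that(2) by simp
      ultimately show ?thesis by linarith
    qed
    have pow: "\<exists>k. 4 * (1/2::real)^k < e" if "e > 0" for e
    proof -
      have "\<exists>k. (1/2::real)^k < e/4" using that by (intro real_arch_pow_inv) auto
      then show ?thesis by (auto simp: field_simps)
    qed
    have conv: "\<exists>l. limitin mtopology (\<lambda>k. a (m z k)) l sequentially" if "z \<in> D" for z
    proof -
      have "MCauchy (\<lambda>k. a (m z k))"
        unfolding MCauchy_def
      proof (intro conjI allI impI)
        show "range (\<lambda>k. a (m z k)) \<subseteq> M" using aM by auto
        fix e :: real assume "e > 0"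
        then obtain k where k: "4 * (1/2::real)^k < e/2" using pow[of "e/2"] by auto
        have "d (a (m z n)) (a (m z n')) < e" if "k \<le> n" "k \<le> n'" for n n'
        proof -
          have "d (a (m z n)) (a (m z n')) \<le> d (a (m z k)) (a (m z n)) + d (a (m z k)) (a (m z n'))"
            using triangle[OF aM aM aM] by (metis commute)
          then show ?thesis using near'[OF \<open>z \<in> D\<close> that(1)] near'[OF \<open>z \<in> D\<close> that(2)] k by simp
        qed
        then show "\<exists>N. \<forall>n n'. N \<le> n \<longrightarrow> N \<le> n' \<longrightarrow> d (a (m z n)) (a (m z n')) < e" by blast
      qed
      then show ?thesis using Md(2) unfolding mcomplete_def by blast
    qed
    define \<psi> where "\<psi> z = (SOME l. limitin mtopology (\<lambda>k. a (m z k)) l sequentially)" for z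
    have lim: "limitin mtopology (\<lambda>k. a (m z k)) (\<psi> z) sequentially" if "z \<in> D" for z
      using conv[OF that] unfolding \<psi>_def by (rule someI_ex)
    have \<psi>M: "\<psi> z \<in> M" if "z \<in> D" for z using lim[OF that] limitin_topspace by fastforce
    have \<psi>near: "d (a (m z k)) (\<psi> z) \<le> 4 * (1/2)^k" if "z \<in> D" for z k
    proof (rule ccontr)
      assume "\<not> ?thesis"
      then have "d (a (m z k)) (\<psi> z) - 4 * (1/2)^k > 0" by simp
      then have "\<forall>\<^sub>F n in sequentially. d (a (m z n)) (\<psi> z) < d (a (m z k)) (\<psi> z) - 4 * (1/2)^k"
        using lim[OF that] unfolding limit_metric_sequentially eventually_sequentially by blast
      then obtain n0 where n0: "\<And>n. n \<ge> n0 \<Longrightarrow> d (a (m z n)) (\<psi> z) < d (a (m z k)) (\<psi> z) - 4 * (1/2)^k"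
        unfolding eventually_sequentially by blast
      have "d (a (m z k)) (\<psi> z) \<le> d (a (m z k)) (a (m z (max n0 k))) + d (a (m z (max n0 k))) (\<psi> z)"
        using triangle[OF aM aM \<psi>M[OF that]] by simp
      then show False using n0[of "max n0 k"] near'[OF that, of k "max n0 k"] by auto
    qed
    have \<psi>\<phi>: "\<psi> (\<phi> x) = x" if "x \<in> M" for x
    proof -
      have "d (\<psi> (\<phi> x)) x \<le> e" if "e > 0" for e
      proof -
        obtain k where k: "4 * (1/2::real)^k < e/2" using pow[of "e/2"] \<open>e > 0\<close> by auto
        have "d (\<psi> (\<phi> x)) x \<le> d (a (m (\<phi> x) k)) (\<psi> (\<phi> x)) + d x (a (m (\<phi> x) k))"
          using triangle[OF \<psi>M[OF \<phi>inD[OF \<open>x \<in> M\<close>]] aM \<open>x \<in> M\<close>] by (metis commute)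
        also have "\<dots> \<le> 4 * (1/2)^k + (1/2)^k" using \<psi>near[OF \<phi>inD[OF \<open>x \<in> M\<close>], of k] \<phi>D[OF \<open>x \<in> M\<close>, of k] by (smt (verit))
        also have "\<dots> \<le> e" 
        proof -
          have "0 < (1/2::real)^k" by simp
          with k show ?thesis by linarith
        qed
        finally show ?thesis .
      qed
      then have "d (\<psi> (\<phi> x)) x \<le> 0" by (rule field_le_epsilon[of _ 0, simplified])
      then show ?thesis using nonneg[of "\<psi> (\<phi> x)" x] \<psi>M[OF \<phi>inD[OF that]] that by (metis order_antisym zero)
    qed
    have mm [measurable]: "(\<lambda>z. m z k) \<in> measurable borel (count_space UNIV)" for k
      unfolding m_def by measurable
    have Dm: "D \<in> sets borel" unfolding D_def by measurable
    show thesis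
    proof (rule that[of \<phi> D \<psi>])
      show "\<phi> \<in> N \<rightarrow>\<^sub>M borel"
      proof (rule measurable_coordinatewise_then_product)
        fix i
        have "{x \<in> space N. d x (a n) < r} \<in> sets N" for n r
        proof -
          have "{x \<in> space N. d x (a n) < r} = mball (a n) r" using aM unfolding M[symmetric] by (auto simp: commute)
          then show ?thesis using op by auto
        qed
        then show "(\<lambda>x. \<phi> x i) \<in> N \<rightarrow>\<^sub>M borel" unfolding \<phi>_def by measurable
      qed
      show "\<psi> \<in> restrict_space borel D \<rightarrow>\<^sub>M N"
      proof -
        have "\<psi> \<in> measurable (restrict_space borel D) (sigma (space N) {U. openin T U})"
        proof (rule measurable_measure_of)
          show "{U. openin T U} \<subseteq> Pow (space N)" using T(3) openin_subset by fastforce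
          show "\<psi> \<in> space (restrict_space borel D) \<rightarrow> space N" using \<psi>M M by (auto simp: space_restrict_space)
          fix U assume "U \<in> {U. openin T U}"
          then have U: "openin mtopology U" using Md(3) by simp
          \<comment> \<open>\<open>\<psi> z\<close> lies in the closed ball of radius
            \<open>4 * (1/2)^k\<close> around \<open>a (m z k)\<close>, so membership in
            \<open>U\<close> is detected by the countably many conditions
            \<open>m z k \<in> K k\<close>.\<close>
          define K where "K k = {n. mcball (a n) (4 * (1/2)^k) \<subseteq> U}" for k
          have "\<psi> z \<in> U \<longleftrightarrow> (\<exists>k. m z k \<in> K k)" if z: "z \<in> D" for z
          proof
            assume "\<psi> z \<in> U"
            then obtain e where e: "e > 0" "mball (\<psi> z) e \<subseteq> U" using U openin_mtopology by blast
            obtain k where k: "4 * (1/2::real)^k < e/2" using pow[of "e/2"] e by auto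
            have "mcball (a (m z k)) (4 * (1/2)^k) \<subseteq> mball (\<psi> z) e"
            proof
              fix y assume y: "y \<in> mcball (a (m z k)) (4 * (1/2)^k)"
              then have "y \<in> M" "d (a (m z k)) y \<le> 4 * (1/2)^k" by auto
              moreover have "d (\<psi> z) y \<le> d (a (m z k)) (\<psi> z) + d (a (m z k)) y"
                using triangle[OF \<psi>M[OF z] aM \<open>y \<in> M\<close>] by (metis commute)
              ultimately show "y \<in> mball (\<psi> z) e" using \<psi>near[OF z, of k] k \<psi>M[OF z] by auto
            qed
            then show "\<exists>k. m z k \<in> K k" using e K_def by blast
          next
            assume "\<exists>k. m z k \<in> K k"
            then show "\<psi> z \<in> U" using \<psi>near[OF z] \<psi>M[OF z] aM unfolding K_def by auto
          qed
          then have "\<psi> -` U \<inter> space (restrict_space borel D) = {z. \<exists>k. m z k \<in> K k} \<inter> D"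
            by (auto simp: space_restrict_space)
          moreover have "{z. \<exists>k. m z k \<in> K k} \<in> sets borel" by measurable
          ultimately show "\<psi> -` U \<inter> space (restrict_space borel D) \<in> sets (restrict_space borel D)"
            using Dm by (auto simp: sets_restrict_space Int_commute)
        qed
        moreover have "sets (sigma (space N) {U. openin T U}) = sets N"
          using sN T(3) openin_subset by (subst sets_measure_of) fastforce+
        ultimately show ?thesis using measurable_cong_sets by blast
      qed
    qed (use Dm \<phi>inD \<psi>\<phi> M in \<open>auto simp: \<phi>_def\<close>)
  qed
qed

text \<open>The projected set is closed rather than Borel: a point of a closed set of sequences is
  recognised by its finite approximations, which the compactness arguments below require.\<close>

definition suslin :: "'a::metric_space set \<Rightarrow> bool" where
  "suslin A \<longleftrightarrow> (\<exists>F :: ('a \<times> (nat \<Rightarrow> nat)) set. closed F \<and> A = fst ` F)"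

lemma suslin_closed:
  assumes "closed A" shows "suslin A"
proof -
  have "closed (A \<times> (UNIV :: (nat \<Rightarrow> nat) set))" using assms by (intro closed_Times) auto
  then show ?thesis unfolding suslin_def by (intro exI[of _ "A \<times> UNIV"]) (auto intro!: image_eqI)
qed

lemma continuous_on_reindex:
  "continuous_on UNIV (\<lambda>p. (fst p, \<lambda>n. snd p (r n)) :: 'a::topological_space \<times> (nat \<Rightarrow> 'b::topological_space))"
  by (intro continuous_on_Pair continuous_on_fst continuous_on_id continuous_on_coordinatewise_then_product
      continuous_on_compose2[OF continuous_on_product_coordinates continuous_on_snd]) auto

text \<open>The first entry of the new witness selects the index \<open>i\<close>, the remaining
  ones form a witness for \<open>A i\<close>.\<close>

lemma suslin_UN:
  assumes "\<And>i::nat. suslin (A i)" shows "suslin (\<Union>i. A i)"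
proof -
  obtain F :: "nat \<Rightarrow> ('a \<times> (nat \<Rightarrow> nat)) set" where F: "\<And>i. closed (F i)" "\<And>i. A i = fst ` F i"
    using assms unfolding suslin_def by metis
  define G where "G = (\<Inter>k. {p. snd p 0 \<noteq> k} \<union> {p. (fst p, \<lambda>n. snd p (Suc n)) \<in> F k})"
  have "closed {p :: 'a \<times> (nat \<Rightarrow> nat). snd p 0 \<noteq> k}" for k
  proof -
    have "continuous_on UNIV (\<lambda>p :: 'a \<times> (nat \<Rightarrow> nat). snd p 0)"
      by (intro continuous_on_compose2[OF continuous_on_product_coordinates continuous_on_snd]) auto
    then have "closed ((\<lambda>p :: 'a \<times> (nat \<Rightarrow> nat). snd p 0) -` (- {k}))"
      by (intro closed_vimage) (auto simp: open_discrete closed_def)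
    then show ?thesis by (simp add: vimage_def)
  qed
  moreover have "closed {p :: 'a \<times> (nat \<Rightarrow> nat). (fst p, \<lambda>n. snd p (Suc n)) \<in> F k}" for k
    using closed_vimage[OF F(1) continuous_on_reindex, of Suc k] by (simp add: vimage_def)
  ultimately have "closed G" unfolding G_def by blast
  moreover have "(\<Union>i. A i) = fst ` G"
  proof (intro equalityI subsetI)
    fix x assume "x \<in> (\<Union>i. A i)"
    then obtain i f where "(x, f) \<in> F i" using F(2) by auto
    then have "(x, case_nat i f) \<in> G" unfolding G_def by auto
    then show "x \<in> fst ` G" by force
  qed (use F(2) in \<open>force simp: G_def\<close>)
  ultimately show ?thesis unfolding suslin_def by blast
qed

text \<open>One sequence carries witnesses for all \<open>A i\<close> at once, separated by the
  pairing function.\<close>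

lemma suslin_INT:
  assumes "\<And>i::nat. suslin (A i)" shows "suslin (\<Inter>i. A i)"
proof -
  obtain F :: "nat \<Rightarrow> ('a \<times> (nat \<Rightarrow> nat)) set" where F: "\<And>i. closed (F i)" "\<And>i. A i = fst ` F i"
    using assms unfolding suslin_def by metis
  define G where "G = (\<Inter>k. {p. (fst p, \<lambda>n. snd p (prod_encode (k, n))) \<in> F k})"
  have "closed {p :: 'a \<times> (nat \<Rightarrow> nat). (fst p, \<lambda>n. snd p (prod_encode (k, n))) \<in> F k}" for k
    using closed_vimage[OF F(1) continuous_on_reindex, of "\<lambda>n. prod_encode (k, n)" k] by (simp add: vimage_def)
  then have "closed G" unfolding G_def by blast
  moreover have "(\<Inter>i. A i) = fst ` G"
  proof (intro equalityI subsetI)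
    fix x assume "x \<in> (\<Inter>i. A i)"
    then have "\<forall>i. \<exists>f. (x, f) \<in> F i" using F(2) by (metis INT_iff UNIV_I imageE prod.collapse)
    then obtain f where "\<And>i. (x, f i) \<in> F i" by metis
    then have "(x, \<lambda>m. f (fst (prod_decode m)) (snd (prod_decode m))) \<in> G" unfolding G_def by auto
    then show "x \<in> fst ` G" by force
  qed (use F(2) in \<open>force simp: G_def\<close>)
  ultimately show ?thesis unfolding suslin_def by blast
qed

lemma suslin_open:
  assumes "open (U :: 'a::metric_space set)" shows "suslin U"
proof (cases "- U = {}")
  \<comment> \<open>Treated apart because \<open>infdist\<close> to the empty set is 0, which would
    empty the closed pieces used below.\<close>
  case True then show ?thesis using suslin_closed[of UNIV] by (metis closed_UNIV double_complement compl_bot_eq)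
next
  case False
  have "U = (\<Union>n. {x. 1 / real (Suc n) \<le> infdist x (- U)})"
  proof (intro equalityI subsetI)
    fix x assume "x \<in> U"
    then have "infdist x (- U) \<noteq> 0" using in_closed_iff_infdist_zero[OF closed_Compl[OF assms] False] by auto
    then have "infdist x (- U) > 0" using infdist_nonneg[of x "- U"] by linarith
    then obtain n where "1 / real (Suc n) < infdist x (- U)" using nat_approx_posE by metis
    then show "x \<in> (\<Union>n. {x. 1 / real (Suc n) \<le> infdist x (- U)})" by (auto intro: less_imp_le)
  next
    fix x assume "x \<in> (\<Union>n. {x. 1 / real (Suc n) \<le> infdist x (- U)})"
    then obtain n where "1 / real (Suc n) \<le> infdist x (- U)" by auto
    then have "infdist x (- U) > 0" by (smt (verit) of_nat_0_less_iff zero_less_Suc zero_less_divide_1_iff)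
    then show "x \<in> U" using infdist_zero by force
  qed
  moreover have "closed {x. 1 / real (Suc n) \<le> infdist x (- U)}" for n
    by (intro closed_Collect_le continuous_intros)
  ultimately show ?thesis using suslin_UN suslin_closed by (metis (no_types, lifting))
qed

lemma suslin_borel:
  assumes "A \<in> sets borel" shows "suslin (A :: 'a::metric_space set)"
proof -
  have "A \<in> sigma_sets UNIV {S :: 'a set. open S}" using assms by (simp add: borel_def)
  \<comment> \<open>Suslin sets are not closed under complement, so the induction carries both
    sets.\<close>
  then have "suslin A \<and> suslin (- A)"
  proof induction
    case (Basic a) then show ?case using suslin_open suslin_closed[of "- a"] by auto
  next
    case Empty then show ?case using suslin_closed[of "{}"] suslin_closed[of UNIV] by auto
  next
    case (Compl a) then show ?case by (simp add: Compl_eq_Diff_UNIV[symmetric])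
  next
    case (Union a) then show ?case using suslin_UN[of a] suslin_INT[of "\<lambda>i. - a i"] by (simp add: Compl_UN)
  qed
  then show ?thesis ..
qed

section \<open>Approximating an analytic quasi-order\<close>

text \<open>Compactness of a product of finite sets: the \<open>Q n\<close> are decreasing nonempty
  clopen conditions. The solution is built digit by digit, keeping prefixes that extend to solutions
  of every \<open>Q n\<close>.\<close>

lemma koenig_product:
  fixes Q :: "nat \<Rightarrow> (nat \<Rightarrow> 'a) \<Rightarrow> bool"
  assumes fin: "\<And>i. finite (A i)"
    and ex: "\<And>n. \<exists>f. (\<forall>i. f i \<in> A i) \<and> Q n f"
    and dep: "\<And>n f g. Q n f \<Longrightarrow> (\<And>i. i < n \<Longrightarrow> f i = g i) \<Longrightarrow> Q n g"
    and dec: "\<And>n f. Q (Suc n) f \<Longrightarrow> Q n f"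
  shows "\<exists>f. (\<forall>i. f i \<in> A i) \<and> (\<forall>n. Q n f)"
proof -
  have dec': "Q m f \<Longrightarrow> n \<le> m \<Longrightarrow> Q n f" for n m f
    by (induction m) (auto simp: le_Suc_eq dest: dec)
  define good where "good k f \<longleftrightarrow> (\<forall>i. f i \<in> A i) \<and>
    (\<forall>n. \<exists>g. (\<forall>i. g i \<in> A i) \<and> (\<forall>i<k. g i = f i) \<and> Q n g)" for k f
  have "\<exists>F. \<forall>k. good k (F k) \<and> (\<forall>i<k. F (Suc k) i = F k i)"
  proof (rule dependent_nat_choice)
    obtain f0 where f0: "\<forall>i. f0 i \<in> A i" using ex by blast
    show "\<exists>x. good 0 x" using f0 ex unfolding good_def by auto
  next
    fix f k assume f: "good k f"
    \<comment> \<open>If each value \<open>a\<close> at \<open>k\<close> failed at some stage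
      \<open>N a\<close>, a solution at the largest of these finitely many stages would also solve
      the stage of its own value.\<close>
    have "\<exists>a\<in>A k. \<forall>n. \<exists>g. (\<forall>i. g i \<in> A i) \<and> (\<forall>i<k. g i = f i) \<and> g k = a \<and> Q n g"
    proof (rule ccontr)
      assume "\<not> ?thesis"
      then obtain N where N: "\<And>a. a \<in> A k \<Longrightarrow>
          \<nexists>g. (\<forall>i. g i \<in> A i) \<and> (\<forall>i<k. g i = f i) \<and> g k = a \<and> Q (N a) g" by metis
      obtain g where g: "\<forall>i. g i \<in> A i" "\<forall>i<k. g i = f i" "Q (Max (N ` A k)) g"
        using f unfolding good_def by blast
      have "N (g k) \<le> Max (N ` A k)" using g fin by (intro Max_ge) auto
      then have "Q (N (g k)) g" using dec'[OF g(3)] by blast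
      then show False using N[of "g k"] g by blast
    qed
    then obtain a where a: "a \<in> A k"
      "\<forall>n. \<exists>g. (\<forall>i. g i \<in> A i) \<and> (\<forall>i<k. g i = f i) \<and> g k = a \<and> Q n g" by blast
    have "good (Suc k) (f(k := a))" unfolding good_def
    proof (intro conjI allI)
      show "(f(k := a)) i \<in> A i" for i using a f unfolding good_def by auto
      fix n obtain g where "\<forall>i. g i \<in> A i" "\<forall>i<k. g i = f i" "g k = a" "Q n g" using a by blast
      then show "\<exists>g. (\<forall>i. g i \<in> A i) \<and> (\<forall>i<Suc k. g i = (f(k := a)) i) \<and> Q n g"
        by (intro exI[of _ g]) (auto simp: less_Suc_eq)
    qed
    then show "\<exists>f'. good (Suc k) f' \<and> (\<forall>i<k. f' i = f i)" by (intro exI[of _ "f(k := a)"]) auto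
  qed
  then obtain F where F: "\<And>k. good k (F k)" "\<And>k i. i < k \<Longrightarrow> F (Suc k) i = F k i" by blast
  have F': "i < k \<Longrightarrow> F k i = F (Suc i) i" for i k
    by (induction k) (auto simp: less_Suc_eq F(2))
  have "Q n (\<lambda>i. F (Suc i) i)" for n
  proof -
    obtain g where g: "\<forall>i<n. g i = F n i" "Q n g" using F(1)[of n] unfolding good_def by blast
    have "g i = F (Suc i) i" if "i < n" for i using g(1) F'[OF that] that by simp
    with g(2) show ?thesis by (rule dep)
  qed
  moreover have "F (Suc i) i \<in> A i" for i using F(1)[of "Suc i"] unfolding good_def by simp
  ultimately show ?thesis by (intro exI[of _ "\<lambda>i. F (Suc i) i"]) simp
qed

section \<open>Finite approximations of witnesses and of chains\<close>

definition cantor :: "(nat \<Rightarrow> nat) set" where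
  "cantor = {a. \<forall>i. a i < 2}"

definition agree :: "nat \<Rightarrow> (nat \<Rightarrow> nat) rel" where
  "agree n = {(a, b). a \<in> cantor \<and> b \<in> cantor \<and> (\<forall>i<n. a i = b i)}"

text \<open>Membership of the first \<open>n\<close> digits in the tree of \<open>F\<close>, read on
  infinite sequences.\<close>

definition near :: "((nat \<Rightarrow> nat) \<times> (nat \<Rightarrow> nat) \<times> (nat \<Rightarrow> nat)) set \<Rightarrow> nat \<Rightarrow> (nat \<Rightarrow> nat) \<Rightarrow> (nat \<Rightarrow> nat) \<Rightarrow> (nat \<Rightarrow> nat) \<Rightarrow> bool" where
  "near F n a b f \<longleftrightarrow> (\<exists>a' b' f'. (a', b', f') \<in> F \<and> (\<forall>i<n. a i = a' i \<and> b i = b' i \<and> f i = f' i))"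

lemma near_cong:
  assumes "near F n a b f" "m \<le> n" "\<And>i. i < m \<Longrightarrow> a' i = a i" "\<And>i. i < m \<Longrightarrow> b' i = b i" "\<And>i. i < m \<Longrightarrow> f' i = f i"
  shows "near F m a' b' f'"
proof -
  obtain a0 b0 f0 where "(a0, b0, f0) \<in> F" "\<forall>i<n. a i = a0 i \<and> b i = b0 i \<and> f i = f0 i"
    using assms(1) unfolding near_def by blast
  then show ?thesis unfolding near_def using assms(2-)
    by (intro exI[of _ a0] exI[of _ b0] exI[of _ f0]) auto
qed

text \<open>Bounding the witness by \<open>s\<close>, instead of prescribing it, makes the relation
  grow with \<open>s\<close>, so that links with different bounds fit into one chain. It also leaves
  finitely many digits at each place, as compactness requires.\<close>

definition approx :: "((nat \<Rightarrow> nat) \<times> (nat \<Rightarrow> nat) \<times> (nat \<Rightarrow> nat)) set \<Rightarrow> nat \<Rightarrow> (nat \<Rightarrow> nat) \<Rightarrow> (nat \<Rightarrow> nat) rel" where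
  "approx F n s = {(a, b). a \<in> cantor \<and> b \<in> cantor \<and>
     (\<exists>f. (\<forall>i<n. f i < s i) \<and> near F n a b f)}"

text \<open>A tuple \<open>(a, b, f) \<in> F\<close> says that \<open>f\<close> witnesses \<open>a R b\<close>. The first digit of \<open>s\<close> also bounds the
  length of a chain of \<open>R\<close>-steps, so that composing chains adds the digit sequences up to a constant.
  As the witnesses are strictly below \<open>s\<close>, only trivial steps are left when \<open>s 0 = 0\<close>.\<close>

definition chain_approx :: "((nat \<Rightarrow> nat) \<times> (nat \<Rightarrow> nat) \<times> (nat \<Rightarrow> nat)) set \<Rightarrow> nat \<Rightarrow> (nat \<Rightarrow> nat) \<Rightarrow> (nat \<Rightarrow> nat) rel" where
  "chain_approx F n s = (agree n \<union> approx F n s) ^^ Suc (s 0)"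

lemma closed_pointwise_limit:
  assumes "closed F" and "\<And>n. near F n a b f"
  shows "(a, b, f) \<in> F"
proof -
  have "\<forall>n. \<exists>p. p \<in> F \<and> (\<forall>i<n. a i = fst p i \<and> b i = fst (snd p) i \<and> f i = snd (snd p) i)"
    using assms(2) unfolding near_def by force
  then obtain p where p: "\<And>n. p n \<in> F"
    "\<And>n i. i < n \<Longrightarrow> a i = fst (p n) i \<and> b i = fst (snd (p n)) i \<and> f i = snd (snd (p n)) i"
    by metis
  have coord: "(\<lambda>n. u n) \<longlonglongrightarrow> v" if "\<And>n i. i < n \<Longrightarrow> v i = u n i" for u :: "nat \<Rightarrow> nat \<Rightarrow> nat" and v
  proof -
    have "(\<lambda>n. u n i) \<longlonglongrightarrow> v i" for i
    proof (rule tendsto_eventually)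
      have "u n i = v i" if "Suc i \<le> n" for n using \<open>\<And>n i. i < n \<Longrightarrow> v i = u n i\<close>[of i n] that by simp
      then show "\<forall>\<^sub>F n in sequentially. u n i = v i" unfolding eventually_sequentially by blast
    qed
    then show ?thesis 
      using limitin_componentwise[of "\<lambda>_. euclidean" UNIV u v sequentially]
      by (simp add: euclidean_product_topology limitin_canonical_iff)
  qed
  have "(\<lambda>n. (fst (p n), fst (snd (p n)), snd (snd (p n)))) \<longlonglongrightarrow> (a, b, f)"
    by (intro tendsto_Pair coord) (use p(2) in blast)+
  then show ?thesis using closed_sequentially[OF assms(1), of p] p(1) by simp
qed

lemma agree_trans: "agree n O agree n \<subseteq> agree n"
  by (auto simp: agree_def)

lemma approx_cong:
  assumes "(a, b) \<in> approx F n s" "(a', a) \<in> agree n" "(b, b') \<in> agree n"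
  shows "(a', b') \<in> approx F n s"
proof -
  obtain f where f: "\<forall>i<n. f i < s i" "near F n a b f" using assms(1) unfolding approx_def by blast
  have "near F n a' b' f" using f(2) by (rule near_cong) (use assms in \<open>auto simp: agree_def\<close>)
  then show ?thesis using f(1) assms(2,3) unfolding approx_def agree_def by blast
qed

lemma approx_mono:
  assumes "m \<le> n" "\<And>i. i < m \<Longrightarrow> s i \<le> s' i"
  shows "approx F n s \<subseteq> approx F m s'"
proof (clarify)
  fix a b assume "(a, b) \<in> approx F n s"
  then obtain f where f: "\<forall>i<n. f i < s i" "near F n a b f" "a \<in> cantor" "b \<in> cantor"
    unfolding approx_def by blast
  have "near F m a b f" using f(2) assms(1) by (rule near_cong) auto
  moreover have "\<forall>i<m. f i < s' i" using f(1) assms by (meson less_le_trans)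
  ultimately show "(a, b) \<in> approx F m s'" using f unfolding approx_def by blast
qed

lemma relpow_mono: "A \<subseteq> B \<Longrightarrow> A ^^ n \<subseteq> B ^^ n" for A B :: "'a rel"
  by (induction n) (simp_all add: relcomp_mono)

lemma chain_approx_cantor:
  assumes "(a, b) \<in> chain_approx F n s" shows "a \<in> cantor \<and> b \<in> cantor"
proof -
  let ?E = "agree n \<union> approx F n s"
  have sub: "?E \<subseteq> cantor \<times> cantor" by (auto simp: agree_def approx_def)
  obtain c where "(a, c) \<in> ?E" using assms unfolding chain_approx_def by (meson relpow_Suc_D2)
  moreover obtain d where "(d, b) \<in> ?E" using assms unfolding chain_approx_def by (meson relpow_Suc_E)
  ultimately show ?thesis using sub by blast
qed

text \<open>The \<open>agree\<close> step is absorbed into the first link, which only sees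
  \<open>n\<close> digits, so the chain does not get longer.\<close>

lemma chain_approx_left:
  assumes "(a', a) \<in> agree n" "(a, b) \<in> chain_approx F n s" shows "(a', b) \<in> chain_approx F n s"
proof -
  obtain c where c: "(a, c) \<in> agree n \<union> approx F n s" "(c, b) \<in> (agree n \<union> approx F n s) ^^ s 0"
    using assms(2) unfolding chain_approx_def by (meson relpow_Suc_D2)
  have "(c, c) \<in> agree n" using c(1) unfolding agree_def approx_def by auto
  then have "(a', c) \<in> agree n \<union> approx F n s"
    using c(1) assms(1) approx_cong agree_trans by blast
  then show ?thesis unfolding chain_approx_def using c(2) by (rule relpow_Suc_I2)
qed

lemma chain_approx_right:
  assumes "(b, b') \<in> agree n" "(a, b) \<in> chain_approx F n s" shows "(a, b') \<in> chain_approx F n s"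
proof -
  obtain c where c: "(a, c) \<in> (agree n \<union> approx F n s) ^^ s 0" "(c, b) \<in> agree n \<union> approx F n s"
    using assms(2) unfolding chain_approx_def by (meson relpow_Suc_E)
  have "(c, c) \<in> agree n" using c(2) unfolding agree_def approx_def by auto
  then have "(c, b') \<in> agree n \<union> approx F n s"
    using c(2) assms(1) approx_cong agree_trans by blast
  then show ?thesis unfolding chain_approx_def using c(1) by auto
qed

lemma chain_approx_mono:
  assumes "m \<le> n" "0 < n" "s' 0 = s 0" "\<And>i. i < m \<Longrightarrow> s i \<le> s' i"
  shows "chain_approx F n s \<subseteq> chain_approx F m s'"
proof -
  have 1: "agree n \<subseteq> agree m" using assms(1) by (auto simp: agree_def)
  have 2: "approx F n s \<subseteq> approx F m s'"
    using assms(1,4) by (rule approx_mono)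
  show ?thesis unfolding chain_approx_def assms(3) by (rule relpow_mono[OF Un_mono[OF 1 2]])
qed

text \<open>The extra 1 comes from the exponents:
  \<open>Suc (s 0) + Suc (t 0) = Suc (s 0 + t 0 + 1)\<close>.\<close>

lemma chain_approx_compose:
  assumes "(a, b) \<in> chain_approx F n s" "(b, c) \<in> chain_approx F n t"
    "\<And>i. i < n \<Longrightarrow> s i \<le> r i" "\<And>i. i < n \<Longrightarrow> t i \<le> r i" "r 0 = s 0 + t 0 + 1"
  shows "(a, c) \<in> chain_approx F n r"
proof -
  have 1: "approx F n s \<subseteq> approx F n r" using order_refl assms(3) by (rule approx_mono)
  have 2: "approx F n t \<subseteq> approx F n r" using order_refl assms(4) by (rule approx_mono)
  have "(a, b) \<in> (agree n \<union> approx F n r) ^^ Suc (s 0)"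
    using assms(1) relpow_mono[OF Un_mono[OF order_refl 1]] unfolding chain_approx_def by blast
  moreover have "(b, c) \<in> (agree n \<union> approx F n r) ^^ Suc (t 0)"
    using assms(2) relpow_mono[OF Un_mono[OF order_refl 2]] unfolding chain_approx_def by blast
  ultimately have "(a, c) \<in> (agree n \<union> approx F n r) ^^ (Suc (s 0) + Suc (t 0))"
    unfolding relpow_add by blast
  then show ?thesis unfolding chain_approx_def assms(5) by simp
qed

lemma chain_approx_zero:
  assumes "0 < n" "s 0 = 0" shows "chain_approx F n s = agree n"
proof -
  have "approx F n s = {}" using assms unfolding approx_def by auto
  then show ?thesis unfolding chain_approx_def using assms by simp
qed

text \<open>The successor is due to the strict bound on witness digits. One link uses the witness,
  the others are trivial steps at \<open>b\<close>.\<close>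

lemma chain_approx_witness:
  assumes "(a, b, f) \<in> F" "a \<in> cantor" "b \<in> cantor"
  shows "(a, b) \<in> chain_approx F n (\<lambda>i. Suc (f i))"
proof -
  have 1: "(a, b) \<in> approx F n (\<lambda>i. Suc (f i))" using assms unfolding approx_def near_def by auto
  have "(b, b) \<in> (agree n \<union> approx F n (\<lambda>i. Suc (f i))) ^^ k" for k
    by (induction k) (use assms in \<open>auto simp: agree_def\<close>)
  then show ?thesis unfolding chain_approx_def using 1 by (blast intro: relpow_Suc_I2)
qed

text \<open>Compactness of the Cantor space allows the intermediate points of a chain to be chosen
  uniformly in the level of approximation.\<close>

lemma relpow_Inter_compact:
  assumes dep: "\<And>n a b a' b'. (a, b) \<in> E n \<Longrightarrow> (a', a) \<in> agree n \<Longrightarrow> (b, b') \<in> agree n \<Longrightarrow> (a', b') \<in> E n"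
    and dec: "\<And>n. E (Suc n) \<subseteq> E n" and sub: "\<And>n. E n \<subseteq> cantor \<times> cantor"
    and ab: "\<And>n. (a, b) \<in> E n ^^ k" and c: "a \<in> cantor"
  shows "(a, b) \<in> (\<Inter>n. E n) ^^ k"
  using ab
proof (induction k arbitrary: b)
  case (Suc k)
  have decpow: "E (Suc n) ^^ k \<subseteq> E n ^^ k" for n k by (rule relpow_mono[OF dec])
  have b: "b \<in> cantor" using Suc.prems[of 0] sub[of 0] by (blast elim: relpow_Suc_E)
  \<comment> \<open>Excluding \<open>k = 0\<close> matters: the zeroth power is the identity, which
    is not invariant under \<open>agree n\<close>.\<close>
  have deppow: "(a, c') \<in> E n ^^ k"
    if "(a, c) \<in> E n ^^ k" "(c, c') \<in> agree n" "k > 0" for n c c'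
  proof (cases k)
    case (Suc j)
    then obtain d where d: "(a, d) \<in> E n ^^ j" "(d, c) \<in> E n" using \<open>(a, c) \<in> E n ^^ k\<close> by auto
    then have "(d, d) \<in> agree n" using sub by (auto simp: agree_def)
    then have "(d, c') \<in> E n" using dep d that by blast
    then show ?thesis using d Suc by auto
  qed (use that in auto)
  show ?case
  proof (cases "k = 0")
    case True
    then show ?thesis using Suc.prems by auto
  next
    case False
    have "\<exists>c. (\<forall>i. c i \<in> {..<2}) \<and> (\<forall>n. c \<in> cantor \<and> (a, c) \<in> E n ^^ k \<and> (c, b) \<in> E n)"
    proof -
      \<comment> \<open>Asking only that the prefix of length \<open>n\<close> extends to a suitable
        intermediate point makes \<open>Q n\<close> depend on \<open>n\<close> digits;
        \<open>dep\<close> and \<open>deppow\<close> later replace that extension by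
        \<open>c\<close> itself.\<close>
      define Q where "Q n c \<longleftrightarrow> (\<exists>c'. (\<forall>i<n. c' i = c i) \<and> c' \<in> cantor \<and> (a, c') \<in> E n ^^ k \<and> (c', b) \<in> E n)" for n c
      have "\<exists>c. (\<forall>i. c i \<in> {..<2}) \<and> (\<forall>n. Q n c)"
      proof (rule koenig_product)
        fix n
        obtain c where "(a, c) \<in> E n ^^ k" "(c, b) \<in> E n" using Suc.prems[of n] by auto
        moreover then have "c \<in> cantor" using sub by auto
        ultimately show "\<exists>f. (\<forall>i. f i \<in> {..<2}) \<and> Q n f" unfolding Q_def cantor_def by blast
      next
        fix n f g assume "Q n f" "\<And>i. i < n \<Longrightarrow> f i = g i"
        then show "Q n g" unfolding Q_def by auto
      next
        fix n f assume "Q (Suc n) f"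
        then obtain c' where "\<forall>i<Suc n. c' i = f i" "c' \<in> cantor" "(a, c') \<in> E (Suc n) ^^ k" "(c', b) \<in> E (Suc n)"
          unfolding Q_def by blast
        then show "Q n f" unfolding Q_def using decpow[of k n] dec[of n] by (intro exI[of _ c']) (simp add: subset_iff)
      qed simp
      then obtain c where c: "\<forall>i. c i \<in> {..<2}" "\<forall>n. Q n c" by blast
      have cc: "c \<in> cantor" using c by (auto simp: cantor_def)
      have "(a, c) \<in> E n ^^ k \<and> (c, b) \<in> E n" for n
      proof -
        obtain c' where "\<forall>i<n. c' i = c i" "c' \<in> cantor" "(a, c') \<in> E n ^^ k" "(c', b) \<in> E n"
          using c(2) unfolding Q_def by blast
        then show ?thesis using deppow[of c' n c] dep[of c' b n c b] cc b False by (auto simp: agree_def)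
      qed
      then show ?thesis using c(1) cc by blast
    qed
    then obtain c where c: "\<And>n. (a, c) \<in> E n ^^ k" "\<And>n. (c, b) \<in> E n" by blast
    then show ?thesis using Suc.IH[of c] by auto
  qed
qed auto

text \<open>Compactness is used twice: for the intermediate points of the chain, and for the witness
  of each nontrivial link, whose digits are bounded by \<open>s\<close>.\<close>

lemma chain_approx_limit:
  assumes "closed F" and ab: "\<And>n. 0 < n \<Longrightarrow> (a, b) \<in> chain_approx F n s"
  shows "(a, b) \<in> (Id \<union> {(x, y). \<exists>f. (x, y, f) \<in> F}) ^^ Suc (s 0)"
proof -
  define E where "E n = agree n \<union> approx F n s" for n
  have dec: "E n \<subseteq> E m" if "m \<le> n" for m n
    unfolding E_def using that approx_mono[OF that, of s s F] by (auto simp: agree_def)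
  have sub: "E n \<subseteq> cantor \<times> cantor" for n unfolding E_def agree_def approx_def by auto
  have abn: "(a, b) \<in> E n ^^ Suc (s 0)" for n
  proof (cases "n = 0")
    case True
    have "(a, b) \<in> E 1 ^^ Suc (s 0)" using ab[of 1] unfolding chain_approx_def E_def by simp
    then show ?thesis using relpow_mono[OF dec[of 0 1], of "Suc (s 0)"] True by blast
  next
    case False
    then show ?thesis using ab[of n] unfolding chain_approx_def E_def by simp
  qed
  have dep: "(u', v') \<in> E n" if "(u, v) \<in> E n" "(u', u) \<in> agree n" "(v, v') \<in> agree n" for n u v u' v'
    using that approx_cong[of u v F n s u' v'] agree_trans[of n] unfolding E_def by blast
  have "a \<in> cantor" using chain_approx_cantor[OF ab[of 1]] by simp
  then have "(a, b) \<in> (\<Inter>n. E n) ^^ Suc (s 0)"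
    by (intro relpow_Inter_compact[where E = E, OF dep dec[OF le_SucI[OF order_refl]] sub abn])
  moreover have "(\<Inter>n. E n) \<subseteq> Id \<union> {(x, y). \<exists>f. (x, y, f) \<in> F}"
  proof (rule subrelI)
    fix x y assume xy: "(x, y) \<in> (\<Inter>n. E n)"
    show "(x, y) \<in> Id \<union> {(x, y). \<exists>f. (x, y, f) \<in> F}"
    proof (rule ccontr)
      assume "(x, y) \<notin> Id \<union> {(x, y). \<exists>f. (x, y, f) \<in> F}"
      then have "x \<noteq> y" and ne: "\<nexists>f. (x, y, f) \<in> F" by auto
      then obtain i where i: "x i \<noteq> y i" by auto
      have ap: "(x, y) \<in> approx F n s" for n
      proof -
        \<comment> \<open>Past the digit \<open>i\<close> where \<open>x\<close> and
          \<open>y\<close> differ, \<open>agree\<close> is excluded, and the link must come from an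
          approximate witness.\<close>
        have "(x, y) \<in> E (max n (Suc i))" using xy by blast
        moreover have "(x, y) \<notin> agree (max n (Suc i))" using i unfolding agree_def by (auto intro!: exI[of _ i])
        ultimately have "(x, y) \<in> approx F (max n (Suc i)) s" unfolding E_def by auto
        then show ?thesis using approx_mono[of n "max n (Suc i)" s s F] by auto
      qed
      \<comment> \<open>The closed range contains 0 even if \<open>s i = 0\<close>, so a witness
        bounded on its first \<open>n\<close> places can be padded with zeros.\<close>
      have "\<exists>f. (\<forall>i. f i \<in> {..s i}) \<and> (\<forall>n. near F n x y f)"
      proof (rule koenig_product)
        fix n
        obtain f where f: "\<forall>i<n. f i < s i" "near F n x y f" using ap[of n] unfolding approx_def by blast
        have "near F n x y (\<lambda>i. if i < n then f i else 0)" using f(2) by (rule near_cong) auto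
        then show "\<exists>f. (\<forall>i. f i \<in> {..s i}) \<and> near F n x y f"
          using f(1) by (intro exI[of _ "\<lambda>i. if i < n then f i else 0"]) (auto intro: less_imp_le)
      qed (auto elim: near_cong)
      then obtain f where "\<And>n. near F n x y f" by blast
      then have "(x, y, f) \<in> F" by (rule closed_pointwise_limit[OF assms(1)])
      then show False using ne by blast
    qed
  qed
  ultimately show ?thesis using relpow_mono by blast
qed

section \<open>Monotone maps of non-scattered orders\<close>

text \<open>The negation of "the open interval from \<open>a\<close> to \<open>b\<close> is
  scattered" for \<open>a < b\<close>, the relation behind condensations of linear orders.\<close>

definition rich :: "'l::linorder \<Rightarrow> 'l \<Rightarrow> bool" where
  "rich a b \<longleftrightarrow> (\<exists>f :: rat \<Rightarrow> 'l. strict_mono f \<and> (\<forall>q. a < f q \<and> f q < b))"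

lemma rich_less: "rich a b \<Longrightarrow> a < b"
  unfolding rich_def by (meson less_trans)

lemma rich_mono: "rich a b \<Longrightarrow> a' \<le> a \<Longrightarrow> b \<le> b' \<Longrightarrow> rich a' b'"
  unfolding rich_def by (meson le_less_trans less_le_trans)

text \<open>An order embedding of the rationals into the open unit interval, based on
  \<open>x / (1 + \<bar>x\<bar>)\<close>, which takes values strictly between -1 and 1.\<close>

definition squash :: "rat \<Rightarrow> rat" where
  "squash x = (1 + x / (1 + \<bar>x\<bar>)) / 2"

lemma squash_bounds: "0 < squash x" "squash x < 1"
proof -
  have "0 < 1 + \<bar>x\<bar>" by linarith
  then have "-1 < x / (1 + \<bar>x\<bar>)" "x / (1 + \<bar>x\<bar>) < 1"
    by (auto simp: pos_less_divide_eq pos_divide_less_eq abs_if)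
  then show "0 < squash x" "squash x < 1" unfolding squash_def by simp_all
qed

lemma strict_mono_squash: "strict_mono squash"
proof (rule strict_monoI)
  fix x y :: rat assume xy: "x < y"
  have "0 < 1 + \<bar>x\<bar>" "0 < 1 + \<bar>y\<bar>" by linarith+
  moreover have "x * (1 + \<bar>y\<bar>) < y * (1 + \<bar>x\<bar>)"
  proof (cases "0 \<le> x \<or> y \<le> 0")
    case True
    then show ?thesis using xy by (auto simp: algebra_simps abs_if)
  next
    case False
    then have "x * (1 + \<bar>y\<bar>) < 0" "0 < y * (1 + \<bar>x\<bar>)" using \<open>0 < 1 + \<bar>x\<bar>\<close> \<open>0 < 1 + \<bar>y\<bar>\<close>
      by (auto simp: mult_less_0_iff zero_less_mult_iff)
    then show ?thesis by linarith
  qed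
  ultimately have "x / (1 + \<bar>x\<bar>) < y / (1 + \<bar>y\<bar>)" by (simp add: divide_less_eq less_divide_eq mult.commute)
  then show "squash x < squash y" unfolding squash_def by (intro divide_strict_right_mono add_strict_left_mono) auto
qed

lemma rich_of_rat:
  assumes f: "strict_mono (f :: rat \<Rightarrow> 'l::linorder)" and "p < q" shows "rich (f p) (f q)"
proof -
  define g where "g x = f (p + (q - p) * squash x)" for x
  have "strict_mono g"
    using strict_mono_squash assms unfolding g_def strict_mono_def by simp
  moreover have "f p < g x" "g x < f q" for x
  proof -
    have "0 < (q - p) * squash x" "(q - p) * squash x < (q - p) * 1"
      using squash_bounds[of x] assms(2) by (simp_all del: mult_1_right)
    then show "f p < g x" "g x < f q" using f unfolding g_def by (simp_all add: strict_mono_less)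
  qed
  ultimately show ?thesis unfolding rich_def by blast
qed

text \<open>Either the part of the copy of the rationals above \<open>f 0\<close> or the part below
  it lies on one side of \<open>c\<close>. This is the fact that a sum of two scattered orders is
  scattered.\<close>

lemma rich_split:
  assumes "rich a b" shows "rich a c \<or> rich c b"
proof -
  obtain f :: "rat \<Rightarrow> 'a" where f: "strict_mono f" "\<And>q. a < f q" "\<And>q. f q < b"
    using assms unfolding rich_def by blast
  show ?thesis
  proof (cases "c \<le> f 0")
    case True
    then show ?thesis using rich_mono[OF rich_of_rat[OF f(1), of 0 1]] f(3)[of 1] by (auto intro: less_imp_le)
  next
    case False
    then show ?thesis using rich_mono[OF rich_of_rat[OF f(1), of "-1" 0]] f(2)[of "-1"] by (auto intro: less_imp_le)
  qed
qed

lemma rich_between: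
  assumes "rich a b" obtains c where "rich a c" "rich c b"
proof -
  obtain f :: "rat \<Rightarrow> 'a" where f: "strict_mono f" "\<And>q. a < f q" "\<And>q. f q < b"
    using assms unfolding rich_def by blast
  have "rich a (f 0)" using rich_mono[OF rich_of_rat[OF f(1), of "-1" 0]] f(2)[of "-1"] by (auto intro: less_imp_le)
  moreover have "rich (f 0) b" using rich_mono[OF rich_of_rat[OF f(1), of 0 1]] f(3)[of 1] by (auto intro: less_imp_le)
  ultimately show thesis by (rule that)
qed

text \<open>Every value carries two points with a copy of the rationals between them, so that the
  fibres of the limiting map are non-scattered.\<close>

definition partial_fibration :: "'v::linorder set \<Rightarrow> ('l::linorder \<times> 'v) set \<Rightarrow> bool" where
  "partial_fibration V G \<longleftrightarrow> finite G \<and> snd ` G \<subseteq> V \<and>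
     (\<forall>l v l' v'. (l, v) \<in> G \<longrightarrow> (l', v') \<in> G \<longrightarrow> v < v' \<longrightarrow> rich l l') \<and>
     (\<forall>v \<in> snd ` G. \<exists>l l'. (l, v) \<in> G \<and> (l', v) \<in> G \<and> rich l l')"

text \<open>The new point receives the least value that has a point not rich below \<open>l\<close>.
  Smaller values then satisfy the requirement by minimality, larger ones by
  \<open>rich_split\<close>. If there is no such value, the top value \<open>v1\<close>
  works.\<close>

lemma partial_fibration_extend_point:
  assumes G: "partial_fibration V G" and V: "v0 \<in> snd ` G" "v1 \<in> snd ` G" "\<And>v. v \<in> V \<Longrightarrow> v0 \<le> v \<and> v \<le> v1"
  shows "\<exists>v. partial_fibration V (insert (l, v) G)"
proof -
  have fin: "finite G" and GV: "\<And>k v. (k, v) \<in> G \<Longrightarrow> v \<in> V"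
    and r: "\<And>k v k' v'. (k, v) \<in> G \<Longrightarrow> (k', v') \<in> G \<Longrightarrow> v < v' \<Longrightarrow> rich k k'"
    and d: "\<And>v. v \<in> snd ` G \<Longrightarrow> \<exists>k k'. (k, v) \<in> G \<and> (k', v) \<in> G \<and> rich k k'"
    using G unfolding partial_fibration_def by (blast, force, blast, blast)
  define B where "B = {v'. \<exists>l'. (l', v') \<in> G \<and> \<not> rich l' l}"
  have "B \<subseteq> snd ` G" unfolding B_def by force
  then have finB: "finite B" using fin finite_surj by blast
  have "\<exists>v \<in> snd ` G. \<forall>l' v'. (l', v') \<in> G \<longrightarrow> (v' < v \<longrightarrow> rich l' l) \<and> (v < v' \<longrightarrow> rich l l')"
  proof (cases "B = {}")
    case True
    have "rich l' l" if "(l', v') \<in> G" for l' v' using True that unfolding B_def by blast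
    moreover have "\<not> v1 < v'" if "(l', v') \<in> G" for l' v' using V(3)[OF GV[OF that]] by auto
    ultimately have "\<forall>l' v'. (l', v') \<in> G \<longrightarrow> (v' < v1 \<longrightarrow> rich l' l) \<and> (v1 < v' \<longrightarrow> rich l l')" by blast
    then show ?thesis using V(2) by blast
  next
    case False
    define v where "v = Min B"
    have "v \<in> B" unfolding v_def using finB False by (rule Min_in)
    then obtain l1 where l1: "(l1, v) \<in> G" "\<not> rich l1 l" unfolding B_def by blast
    have "rich l' l" if "(l', v') \<in> G" "v' < v" for l' v'
    proof (rule ccontr)
      assume "\<not> rich l' l"
      then have "v' \<in> B" using that unfolding B_def by blast
      then show False using that(2) Min_le[OF finB] unfolding v_def by force
    qed
    moreover have "rich l l'" if "(l', v') \<in> G" "v < v'" for l' v'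
      using rich_split[OF r[OF l1(1) that], of l] l1(2) by blast
    ultimately show ?thesis using l1(1) by (force intro!: bexI[of _ v])
  qed
  then obtain v where v: "v \<in> snd ` G" "\<And>l' v'. (l', v') \<in> G \<Longrightarrow> v' < v \<Longrightarrow> rich l' l"
    "\<And>l' v'. (l', v') \<in> G \<Longrightarrow> v < v' \<Longrightarrow> rich l l'" by blast
  have "partial_fibration V (insert (l, v) G)"
    unfolding partial_fibration_def
  proof (intro conjI allI impI ballI)
    show "finite (insert (l, v) G)" using fin by simp
    show "snd ` insert (l, v) G \<subseteq> V" using v(1) GV by auto
    show "rich k k'" if "(k, u) \<in> insert (l, v) G" "(k', u') \<in> insert (l, v) G" "u < u'" for k u k' u'
      using that r v(2,3) by auto
    show "\<exists>k k'. (k, u) \<in> insert (l, v) G \<and> (k', u) \<in> insert (l, v) G \<and> rich k k'"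
      if "u \<in> snd ` insert (l, v) G" for u using d[of u] that v(1) by auto
  qed
  then show ?thesis by blast
qed

text \<open>The last assigned point with smaller value and the first with larger value are rich, so
  two points that are rich to each other and to both of these fit in between.\<close>

lemma partial_fibration_extend_value:
  assumes G: "partial_fibration V G" and V: "v0 \<in> snd ` G" "v1 \<in> snd ` G" "\<And>v. v \<in> V \<Longrightarrow> v0 \<le> v \<and> v \<le> v1"
    and v: "v \<in> V"
  shows "\<exists>G'. partial_fibration V G' \<and> G \<subseteq> G' \<and> v \<in> snd ` G'"
proof (cases "v \<in> snd ` G")
  case False
  have fin: "finite G" and GV: "\<And>k v. (k, v) \<in> G \<Longrightarrow> v \<in> V"
    and r: "\<And>k v k' v'. (k, v) \<in> G \<Longrightarrow> (k', v') \<in> G \<Longrightarrow> v < v' \<Longrightarrow> rich k k'"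
    and d: "\<And>v. v \<in> snd ` G \<Longrightarrow> \<exists>k k'. (k, v) \<in> G \<and> (k', v) \<in> G \<and> rich k k'"
    using G unfolding partial_fibration_def by (blast, force, blast, blast)
  have v01: "v0 < v" "v < v1" using V v False by (metis order_le_imp_less_or_eq)+
  define A where "A = {l. \<exists>u. (l, u) \<in> G \<and> u < v}"
  define B where "B = {l. \<exists>u. (l, u) \<in> G \<and> v < u}"
  have AB: "A \<subseteq> fst ` G" "B \<subseteq> fst ` G" unfolding A_def B_def by force+
  have A: "finite A" "A \<noteq> {}" using AB(1) fin finite_surj V(1) v01 unfolding A_def by (blast, force)
  have B: "finite B" "B \<noteq> {}" using AB(2) fin finite_surj V(2) v01 unfolding B_def by (blast, force)
  define a where "a = Max A"
  define b where "b = Min B"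
  have "a \<in> A" "b \<in> B" unfolding a_def b_def using A B by simp_all
  then have "rich a b" unfolding A_def B_def using r by (blast intro: less_trans)
  then obtain c where c: "rich a c" "rich c b" by (rule rich_between)
  obtain c' where c': "rich c c'" "rich c' b" using c(2) by (rule rich_between)
  have lo: "rich l c" "rich l c'" if "(l, u) \<in> G" "u < v" for l u
  proof -
    have "l \<le> a" unfolding a_def using A that by (intro Max_ge) (auto simp: A_def)
    then show "rich l c" using rich_mono[OF c(1)] by blast
    then show "rich l c'" using rich_mono rich_less[OF c'(1)] by (blast intro: less_imp_le)
  qed
  have hi: "rich c l" "rich c' l" if "(l, u) \<in> G" "v < u" for l u
  proof -
    have "b \<le> l" unfolding b_def using B that by (intro Min_le) (auto simp: B_def)
    then show "rich c' l" using rich_mono[OF c'(2)] by blast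
    then show "rich c l" using rich_mono rich_less[OF c'(1)] by (blast intro: less_imp_le)
  qed
  have "partial_fibration V (insert (c, v) (insert (c', v) G))"
    unfolding partial_fibration_def
  proof (intro conjI allI impI ballI)
    show "finite (insert (c, v) (insert (c', v) G))" using fin by simp
    show "snd ` insert (c, v) (insert (c', v) G) \<subseteq> V" using v GV by auto
    show "rich k k'" if "(k, u) \<in> insert (c, v) (insert (c', v) G)" "(k', u') \<in> insert (c, v) (insert (c', v) G)" "u < u'" for k u k' u'
      using that r lo hi by auto
    show "\<exists>k k'. (k, u) \<in> insert (c, v) (insert (c', v) G) \<and> (k', u) \<in> insert (c, v) (insert (c', v) G) \<and> rich k k'"
      if "u \<in> snd ` insert (c, v) (insert (c', v) G)" for u using d[of u] that c'(1) by auto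
  qed
  then show ?thesis by (intro exI[of _ "insert (c, v) (insert (c', v) G)"]) force
qed (use G in blast)

text \<open>Back and forth: stage \<open>n\<close> gives a value to the \<open>n\<close>-th point of
  the order and points to the \<open>n\<close>-th element of \<open>V\<close>.\<close>

lemma monotone_fibration:
  fixes V :: "'v::linorder set"
  assumes "non_scattered TYPE('l::{countable, linorder})"
    and "countable V" "v0 \<in> V" "v1 \<in> V" "v0 < v1" "\<And>v. v \<in> V \<Longrightarrow> v0 \<le> v \<and> v \<le> v1"
  shows "\<exists>\<pi> :: 'l \<Rightarrow> 'v. mono \<pi> \<and> range \<pi> \<subseteq> V \<and>
    (\<forall>v \<in> V. \<exists>f :: rat \<Rightarrow> 'l. strict_mono f \<and> (\<forall>q. \<pi> (f q) = v))"
proof -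
  obtain f :: "rat \<Rightarrow> 'l" where f: "strict_mono f" using assms(1) unfolding non_scattered_def by blast
  define P where "P n G \<longleftrightarrow> partial_fibration V G \<and> v0 \<in> snd ` G \<and> v1 \<in> snd ` G" for n :: nat and G :: "('l \<times> 'v) set"
  define Q where "Q n G G' \<longleftrightarrow> G \<subseteq> G' \<and> from_nat n \<in> fst ` G' \<and> from_nat_into V n \<in> snd ` G'"
    for n and G G' :: "('l \<times> 'v) set"
  have "\<exists>G. \<forall>n. P n (G n) \<and> Q n (G n) (G (Suc n))"
  proof (rule dependent_nat_choice)
    \<comment> \<open>Two points for each extreme value, so that the extremes too have a copy of the
      rationals in their fibres.\<close>
    have "partial_fibration V {(f 0, v0), (f 1, v0), (f 2, v1), (f 3, v1)}"
      using assms(3-5) rich_of_rat[OF f, of 0 1] rich_of_rat[OF f, of 0 2] rich_of_rat[OF f, of 0 3]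
        rich_of_rat[OF f, of 1 2] rich_of_rat[OF f, of 1 3] rich_of_rat[OF f, of 2 3]
      unfolding partial_fibration_def by auto
    then show "\<exists>G. P 0 G" unfolding P_def by (intro exI[of _ "{(f 0, v0), (f 1, v0), (f 2, v1), (f 3, v1)}"]) auto
  next
    fix G n assume "P n G"
    then have G: "partial_fibration V G" "v0 \<in> snd ` G" "v1 \<in> snd ` G" unfolding P_def by auto
    obtain v where v: "partial_fibration V (insert (from_nat n, v) G)"
      using partial_fibration_extend_point[OF G assms(6)] by blast
    obtain G' where G': "partial_fibration V G'" "insert (from_nat n, v) G \<subseteq> G'" "from_nat_into V n \<in> snd ` G'"
      using partial_fibration_extend_value[OF v _ _ assms(6), of "from_nat_into V n"] G(2,3) assms(3)
      by (metis (no_types, opaque_lifting) emptyE from_nat_into image_insert insertCI)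
    have "from_nat n \<in> fst ` G'" using G'(2) by (force intro: image_eqI[of _ _ "(from_nat n, v)"])
    moreover have "snd ` G \<subseteq> snd ` G'" using G'(2) by blast
    ultimately have "P (Suc n) G' \<and> Q n G G'" using G(2,3) G' unfolding P_def Q_def by blast
    then show "\<exists>G'. P (Suc n) G' \<and> Q n G G'" ..
  qed
  then obtain G :: "nat \<Rightarrow> ('l \<times> 'v) set" where G: "\<And>n. partial_fibration V (G n)" "\<And>n. G n \<subseteq> G (Suc n)"
    "\<And>n. from_nat n \<in> fst ` G (Suc n)" "\<And>n. from_nat_into V n \<in> snd ` G (Suc n)"
    unfolding P_def Q_def by blast
  have Gle: "m \<le> n \<Longrightarrow> G m \<subseteq> G n" for m n using lift_Suc_mono_le[of G] G(2) by blast
  have r: "rich l l'" if "(l, v) \<in> G m" "(l', v') \<in> G n" "v < v'" for l v l' v' m n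
  proof -
    have "(l, v) \<in> G (max m n)" "(l', v') \<in> G (max m n)" using that Gle[of m "max m n"] Gle[of n "max m n"] by auto
    then show ?thesis using G(1)[of "max m n"] that(3) unfolding partial_fibration_def by blast
  qed
  have "\<forall>l. \<exists>v n. (l, v) \<in> G n"
  proof
    fix l :: 'l
    have "l \<in> fst ` G (Suc (to_nat l))" using G(3)[of "to_nat l"] by simp
    then show "\<exists>v n. (l, v) \<in> G n" by force
  qed
  then obtain \<pi> where \<pi>: "\<And>l. \<exists>n. (l, \<pi> l) \<in> G n" by metis
  \<comment> \<open>Two different values at \<open>l\<close> would make \<open>rich l l\<close>
    hold.\<close>
  have uniq: "\<pi> l = v" if "(l, v) \<in> G n" for l v n
    
  proof -
    obtain m where "(l, \<pi> l) \<in> G m" using \<pi> by blast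
    then show ?thesis using r[OF that, of l "\<pi> l" m] r[of l "\<pi> l" m l v n] that rich_less[of l l] by (cases "\<pi> l" v rule: linorder_cases) auto
  qed
  have "mono \<pi>"
  proof (rule monoI, rule ccontr)
    fix l l' assume "l \<le> l'" "\<not> \<pi> l \<le> \<pi> l'"
    then have "rich l' l" using r \<pi>[of l] \<pi>[of l'] by (meson linorder_not_le)
    then have "l' < l" by (rule rich_less)
    then show False using \<open>l \<le> l'\<close> by simp
  qed
  moreover have "range \<pi> \<subseteq> V" 
  proof clarify
    fix l obtain n where "(l, \<pi> l) \<in> G n" using \<pi> by blast
    then have "\<pi> l \<in> snd ` G n" by force
    then show "\<pi> l \<in> V" using G(1)[of n] unfolding partial_fibration_def by blast
  qed
  moreover have "\<exists>f :: rat \<Rightarrow> 'l. strict_mono f \<and> (\<forall>q. \<pi> (f q) = v)" if vV: "v \<in> V" for v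
  proof -
    obtain n where "from_nat_into V n = v" using from_nat_into_surj[OF assms(2) vV] by blast
    then have "v \<in> snd ` G (Suc n)" using G(4)[of n] by simp
    then obtain l l' where l: "(l, v) \<in> G (Suc n)" "(l', v) \<in> G (Suc n)" "rich l l'"
      using G(1)[of "Suc n"] unfolding partial_fibration_def by blast
    \<comment> \<open>The copy of the rationals lies between two points of value \<open>v\<close>,
      and monotonicity of \<open>\<pi>\<close> gives all of it this value.\<close>
    then obtain f :: "rat \<Rightarrow> 'l" where "strict_mono f" "\<And>q. l < f q" "\<And>q. f q < l'"
      unfolding rich_def by blast
    moreover have "\<pi> l = v" "\<pi> l' = v" using uniq l by auto
    ultimately show ?thesis using \<open>mono \<pi>\<close> by (metis less_imp_le monoD order_antisym)
  qed
  ultimately show ?thesis by blast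
qed

text \<open>\<open>\<sigma> l\<close> is the sum of the weights \<open>(1/2)^n\<close> of the strict
  predecessors of \<open>l\<close>; passing to a larger element adds at least the weight of
  \<open>l\<close>. The whole geometric series has sum 2.\<close>

lemma countable_linorder_embeds_real:
  "\<exists>\<sigma> :: 'l::{countable, linorder} \<Rightarrow> real. strict_mono \<sigma> \<and> (\<forall>l. 0 \<le> \<sigma> l \<and> \<sigma> l \<le> 2)"
proof -
  define b where "b l n = (if \<exists>k. n = to_nat k \<and> k < l then (1/2::real)^n else 0)" for l :: 'l and n
  have b0: "0 \<le> b l n" and b1: "b l n \<le> (1/2)^n" for l n unfolding b_def by auto
  have g: "summable (\<lambda>n. (1/2::real)^n)" by (rule summable_geometric) simp
  have s: "summable (b l)" for l by (rule summable_comparison_test'[OF g, of 0]) (use b0 b1 in auto)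
  have "strict_mono (\<lambda>l. suminf (b l))"
  proof (rule strict_monoI)
    fix l l' :: 'l assume "l < l'"
    have le: "b l n \<le> b l' n" for n using \<open>l < l'\<close> unfolding b_def by (auto intro: less_trans)
    have "\<not> (\<exists>k. to_nat l = to_nat k \<and> k < l)" by auto
    then have lt: "b l (to_nat l) < b l' (to_nat l)" using \<open>l < l'\<close> unfolding b_def by auto
    have "0 < (\<Sum>n. b l' n - b l n)"
      by (rule suminf_pos2[where i = "to_nat l"]) (use le lt s in \<open>auto intro: summable_diff\<close>)
    then show "suminf (b l) < suminf (b l')" using suminf_diff[OF s s, of l' l] by simp
  qed
  moreover have "0 \<le> suminf (b l)" for l using suminf_nonneg[OF s] b0 by blast
  moreover have "suminf (b l) \<le> 2" for l
    using suminf_le[OF b1 s g, of l] suminf_geometric[of "1/2::real"] by simp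
  ultimately show ?thesis by blast
qed

text \<open>A section of a monotone map from the rationals onto the values of
  \<open>\<sigma>\<close> is strictly increasing. The values -1 and 3 lie outside the range of
  \<open>\<sigma>\<close> and supply the extremes that \<open>monotone_fibration\<close> asks
  for.\<close>

lemma countable_linorder_embeds_rat:
  "\<exists>\<iota> :: 'l::{countable, linorder} \<Rightarrow> rat. strict_mono \<iota> \<and> (\<forall>l. 0 < \<iota> l \<and> \<iota> l < 1)"
proof -
  obtain \<sigma> :: "'l \<Rightarrow> real" where \<sigma>: "strict_mono \<sigma>" "\<And>l. 0 \<le> \<sigma> l" "\<And>l. \<sigma> l \<le> 2"
    using countable_linorder_embeds_real by blast
  have ns: "non_scattered TYPE(rat)"
    unfolding non_scattered_def by (intro exI[of _ "\<lambda>x. x"]) (simp add: strict_mono_def)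
  have "\<exists>\<pi> :: rat \<Rightarrow> real. mono \<pi> \<and> range \<pi> \<subseteq> insert (-1) (insert 3 (range \<sigma>)) \<and>
     (\<forall>v \<in> insert (-1) (insert 3 (range \<sigma>)). \<exists>f :: rat \<Rightarrow> rat. strict_mono f \<and> (\<forall>q. \<pi> (f q) = v))"
  proof (rule monotone_fibration[OF ns, where ?v0.0 = "-1" and ?v1.0 = 3])
    fix v assume "v \<in> insert (-1) (insert 3 (range \<sigma>))"
    then consider "v = -1" | "v = 3" | l where "v = \<sigma> l" by blast
    then show "-1 \<le> v \<and> v \<le> 3"
    proof cases
      case (3 l)
      then show ?thesis using \<sigma>(2,3)[of l] by simp
    qed auto
  qed auto
  then obtain \<pi> :: "rat \<Rightarrow> real" where \<pi>: "mono \<pi>"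
    and fib: "\<forall>v \<in> insert (-1) (insert 3 (range \<sigma>)). \<exists>f :: rat \<Rightarrow> rat. strict_mono f \<and> (\<forall>q. \<pi> (f q) = v)"
    by (elim exE conjE)
  have "\<exists>q. \<pi> q = \<sigma> l" for l using bspec[OF fib, of "\<sigma> l"] by auto
  then obtain \<iota> where \<iota>: "\<And>l. \<pi> (\<iota> l) = \<sigma> l" by metis
  have "strict_mono \<iota>"
  proof (rule strict_monoI, rule ccontr)
    fix l l' assume "l < l'" "\<not> \<iota> l < \<iota> l'"
    then have "\<pi> (\<iota> l') \<le> \<pi> (\<iota> l)" using \<pi> by (simp add: monoD)
    then show False using \<iota> \<sigma>(1) \<open>l < l'\<close> by (metis linorder_not_le strict_monoD)
  qed
  then have "strict_mono (squash \<circ> \<iota>)" using strict_mono_squash by (simp add: strict_mono_def)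
  then show ?thesis using squash_bounds by (intro exI[of _ "squash \<circ> \<iota>"]) simp
qed

section \<open>Finite sequences as reals\<close>

text \<open>In the induced order a node precedes its children \<open>\<dots>, w @ [2], w @ [1], w @ [0]\<close>, which occur in
  order of decreasing last digit.\<close>

fun node_pos :: "nat list \<Rightarrow> real" where
  "node_pos [] = 0"
| "node_pos (a # w) = (1 + node_pos w) / 2 ^ Suc a"

lemma node_pos_nonneg: "0 \<le> node_pos w"
  by (induction w) auto

lemma node_pos_less_one: "node_pos w < 1"
proof (induction w)
  case (Cons a w)
  have "(1 + node_pos w) / 2 ^ Suc a < 2 / 2 ^ Suc a" using Cons by (intro divide_strict_right_mono) auto
  also have "\<dots> = 1 / 2 ^ a" by simp
  also have "\<dots> \<le> (1::real)" by (simp add: divide_le_eq)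
  finally show ?case by simp
qed simp

lemma node_pos_Cons_pos: "0 < node_pos (a # w)"
  using node_pos_nonneg[of w] by (simp add: zero_less_divide_iff)

text \<open>Sequences starting with \<open>a\<close> occupy the interval from
  \<open>1 / 2 ^ Suc a\<close> (included) to \<open>1 / 2 ^ a\<close> (excluded), and these
  intervals move down as \<open>a\<close> grows.\<close>

lemma node_pos_Cons_lt:
  assumes "b < a" shows "node_pos (a # w) < node_pos (b # w')"
proof -
  have "node_pos (a # w) < 2 / 2 ^ Suc a"
    unfolding node_pos.simps by (intro divide_strict_right_mono) (use node_pos_less_one[of w] in auto)
  also have "\<dots> = 1 / 2 ^ a" by simp
  also have "\<dots> \<le> (1::real) / 2 ^ Suc b"
    using assms by (intro divide_left_mono power_increasing) auto
  also have "\<dots> \<le> node_pos (b # w')"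
    using node_pos_nonneg[of w'] unfolding node_pos.simps by (intro divide_right_mono) auto
  finally show ?thesis .
qed

lemma node_pos_Cons_less_iff:
  "node_pos (a # w) < node_pos (b # w') \<longleftrightarrow> b < a \<or> a = b \<and> node_pos w < node_pos w'"
proof (cases a b rule: linorder_cases)
  case equal
  then show ?thesis by (simp add: divide_less_cancel)
qed (use node_pos_Cons_lt[of a b w' w] node_pos_Cons_lt[of b a w w'] in auto)

lemma node_pos_Nil_less_iff: "node_pos [] < node_pos w \<longleftrightarrow> w \<noteq> []"
  using node_pos_Cons_pos by (cases w) (auto simp del: node_pos.simps(2))

lemma not_node_pos_less_Nil: "\<not> node_pos w < node_pos []"
  using node_pos_nonneg[of w] by simp

lemmas node_pos_less_simps = node_pos_Cons_less_iff node_pos_Nil_less_iff not_node_pos_less_Nil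

lemma node_pos_append_less_iff: "node_pos (p @ w) < node_pos (p @ w') \<longleftrightarrow> node_pos w < node_pos w'"
  by (induction p) (simp_all add: node_pos_less_simps del: node_pos.simps)

lemma node_pos_less_append: "v \<noteq> [] \<Longrightarrow> node_pos w < node_pos (w @ v)"
  using node_pos_append_less_iff[of w "[]" v] by (simp add: node_pos_less_simps del: node_pos.simps)

lemma inj_node_pos: "inj node_pos"
proof (rule injI)
  show "w = w'" if "node_pos w = node_pos w'" for w w'
    using that
  proof (induction w arbitrary: w')
    case Nil then show ?case using node_pos_Nil_less_iff[of w'] by auto
  next
    case (Cons a w)
    then obtain b v where w': "w' = b # v"
      using node_pos_Nil_less_iff[of "a # w"] by (cases w') (auto simp del: node_pos.simps(2))
    have "\<not> node_pos (a # w) < node_pos (b # v)" "\<not> node_pos (b # v) < node_pos (a # w)"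
      using Cons.prems w' by auto
    then have "a = b" "\<not> node_pos w < node_pos v" "\<not> node_pos v < node_pos w"
      unfolding node_pos_Cons_less_iff by auto
    then show ?case using Cons.IH[of v] w' by auto
  qed
qed

text \<open>Moving up among nodes of one length is a descent in a well-founded order. Fixing the
  length is essential: \<open>[]\<close>, \<open>[0]\<close>, \<open>[0, 0]\<close>, ... is
  increasing.\<close>

lemma lenlex_of_node_pos_less:
  "length w = length w' \<Longrightarrow> node_pos w < node_pos w' \<Longrightarrow> (w', w) \<in> lenlex less_than"
proof (induction w w' rule: list_induct2)
  case (Cons a w b w')
  then show ?case unfolding node_pos_Cons_less_iff by (auto simp: Cons_lenlex_iff)
qed simp

text \<open>Adding even numbers keeps the parities, which carry the points of the Cantor space.\<close>

fun shift :: "(nat \<Rightarrow> nat) \<Rightarrow> nat list \<Rightarrow> nat list" where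
  "shift \<beta> [] = []"
| "shift \<beta> (a # w) = (a + 2 * \<beta> 0) # shift (\<beta> \<circ> Suc) w"

lemma length_shift [simp]: "length (shift \<beta> w) = length w"
  by (induction w arbitrary: \<beta>) auto

lemma nth_shift: "i < length w \<Longrightarrow> shift \<beta> w ! i = w ! i + 2 * \<beta> i"
  by (induction w arbitrary: \<beta> i) (auto simp: nth_Cons split: nat.split)

lemma node_pos_shift_less: "node_pos w < node_pos w' \<Longrightarrow> node_pos (shift \<beta> w) < node_pos (shift \<beta> w')"
proof (induction w arbitrary: \<beta> w')
  case Nil then show ?case by (cases w') (auto simp: node_pos_less_simps simp del: node_pos.simps)
next
  case (Cons a w)
  then obtain b v where "w' = b # v" by (cases w') (auto simp: node_pos_less_simps simp del: node_pos.simps)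
  then show ?case using Cons by (auto simp: node_pos_less_simps simp del: node_pos.simps)
qed

text \<open>Along such a sequence each digit is eventually nonincreasing, once the preceding digits have
  stabilised.\<close>

lemma increasing_nodes_converge:
  assumes len: "\<And>n. length (t n) = n" and inc: "\<And>n. node_pos (t n) < node_pos (t (Suc n))"
  obtains \<alpha> where "\<And>k. \<exists>n \<ge> k. \<forall>i<k. t n ! i = \<alpha> i"
proof -
  have less: "node_pos (t m) < node_pos (t n)" if "m < n" for m n
    using lift_Suc_mono_less[of "\<lambda>n. node_pos (t n)"] inc that by blast
  have "\<exists>p N. \<forall>n\<ge>N. take k (t n) = p" for k
  proof (induction k)
    case (Suc k)
    then obtain p N where pN: "\<And>n. n \<ge> N \<Longrightarrow> take k (t n) = p" by blast
    define M where "M = max N (Suc k)"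
    have dec: "t n = p @ (t n ! k) # drop (Suc k) (t n)" if "M \<le> n" for n
      using that pN[of n] len[of n] id_take_nth_drop[of k "t n"] unfolding M_def by auto
    have mon: "t n ! k \<le> t m ! k" if "M \<le> m" "m \<le> n" for m n
    proof (cases "m = n")
      case False
      then have "node_pos (t m) < node_pos (t n)" using less that by simp
      then show ?thesis
        using dec[of m] dec[of n] that node_pos_append_less_iff node_pos_Cons_less_iff
        by (metis le_trans less_or_eq_imp_le)
    qed simp
    obtain m where m: "M \<le> m" "\<And>n. M \<le> n \<Longrightarrow> t m ! k \<le> t n ! k"
      using ex_has_least_nat[of "\<lambda>n. M \<le> n" M "\<lambda>n. t n ! k"] by auto
    have "take (Suc k) (t n) = p @ [t m ! k]" if "n \<ge> m" for n
    proof -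
      have "t n ! k = t m ! k" using mon[of m n] m(2)[of n] m(1) that by simp
      moreover have "take (Suc k) (t n) = take k (t n) @ [t n ! k]"
        using len[of n] that m(1) by (intro take_Suc_conv_app_nth) (simp add: M_def)
      ultimately show ?thesis using pN[of n] that m(1) unfolding M_def by simp
    qed
    then show ?case by blast
  qed auto
  then obtain p N where pN: "\<And>k n. n \<ge> N k \<Longrightarrow> take k (t n) = p k" by metis
  define \<alpha> where "\<alpha> i = p (Suc i) ! i" for i
  have "\<exists>n \<ge> k. \<forall>i<k. t n ! i = \<alpha> i" for k
  proof -
    define n where "n = Max (insert k (N ` {..k}))"
    have n: "k \<le> n" unfolding n_def by (rule Max_ge) auto
    have n': "N i \<le> n" if "i \<le> k" for i unfolding n_def by (rule Max_ge) (use that in auto)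
    have "t n ! i = \<alpha> i" if "i < k" for i
      using pN[of "Suc i" n] n'[of "Suc i"] that unfolding \<alpha>_def by (metis Suc_leI lessI nth_take)
    then show ?thesis using n by blast
  qed
  then show thesis by (rule that)
qed

text \<open>The relation of a nonempty node to its shifts by positive sequences. Parities agree
  because \<open>shift\<close> adds even numbers; distinctness makes \<open>sum_list\<close> grow
  strictly with every copying.\<close>

definition below :: "nat list \<Rightarrow> nat list \<Rightarrow> bool" where
  "below v w \<longleftrightarrow> v \<noteq> w \<and> list_all2 (\<lambda>a b. a \<le> b \<and> a mod 2 = b mod 2) v w"

definition parity :: "nat list \<Rightarrow> nat list" where
  "parity w = map (\<lambda>a. a mod 2) w"

lemma below_parity: "below v w \<Longrightarrow> parity v = parity w"
  unfolding below_def parity_def by (auto simp: list_all2_conv_all_nth intro: nth_equalityI)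

lemma length_parity [simp]: "length (parity w) = length w"
  by (simp add: parity_def)

lemma below_length: "below v w \<Longrightarrow> length v = length w"
  unfolding below_def by (auto dest: list_all2_lengthD)

lemma below_sum_list: "below v w \<Longrightarrow> sum_list v < sum_list w"
proof -
  have *: "list_all2 (\<lambda>a b. a \<le> b \<and> a mod 2 = b mod 2) v w \<Longrightarrow>
      sum_list v \<le> sum_list w \<and> (v \<noteq> w \<longrightarrow> sum_list v < sum_list w)"
    by (induction rule: list_all2_induct) auto
  then show "below v w \<Longrightarrow> sum_list v < sum_list w" unfolding below_def by blast
qed

lemma finite_below: "finite {v. below v w}"
proof (rule finite_subset)
  show "{v. below v w} \<subseteq> {v. set v \<subseteq> {..sum_list w} \<and> length v = length w}"
  proof (intro subsetI CollectI conjI)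
    fix v a assume "v \<in> {v. below v w}" "a \<in> set v"
    then have v: "below v w" "a \<in> set v" by auto
    then obtain i where i: "i < length v" "a = v ! i" by (auto simp: in_set_conv_nth)
    then have "v ! i \<le> w ! i" "w ! i \<in> set w" using v unfolding below_def by (auto simp: list_all2_conv_all_nth)
    then have "a \<le> sum_list w" using i member_le_sum_list[of "w ! i" w] by simp
    then show "a \<in> {..sum_list w}" by simp
  next
    show "length v = length w" if "v \<in> {v. below v w}" for v using that below_length by blast
  qed
qed (simp add: finite_lists_length_eq)

lemma below_shift:
  assumes "w \<noteq> []" "\<And>i. 0 < \<beta> i" shows "below w (shift \<beta> w)"
proof -
  have "w ! 0 < shift \<beta> w ! 0" using assms by (simp add: nth_shift)
  then have "w \<noteq> shift \<beta> w" by fastforce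
  then show ?thesis unfolding below_def by (simp add: list_all2_conv_all_nth nth_shift)
qed

lemma parity_shift: "parity (shift \<beta> w) = parity w"
  unfolding parity_def by (rule nth_equalityI) (simp_all add: nth_shift)

section \<open>Rigid colourings\<close>

text \<open>The block of \<open>w\<close> is the fibre over \<open>node_pos w\<close>, with
  \<open>f w\<close> a copy of the rationals inside it. The remaining points form the fibre over 1
  and lie above all blocks.\<close>

locale fibred_order =
  fixes \<pi> :: "'l::{countable, linorder} \<Rightarrow> real" and f :: "nat list \<Rightarrow> rat \<Rightarrow> 'l" and \<iota> :: "'l \<Rightarrow> rat"
  assumes mono_\<pi>: "mono \<pi>"
    and range_\<pi>: "\<pi> l = 1 \<or> (\<exists>w. \<pi> l = node_pos w)"
    and strict_mono_f: "strict_mono (f w)"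
    and \<pi>_f: "\<pi> (f w q) = node_pos w"
    and strict_mono_\<iota>: "strict_mono \<iota>"
    and \<iota>_bounds: "0 < \<iota> l" "\<iota> l < 1"
begin

definition node :: "'l \<Rightarrow> nat list" where
  "node l = inv node_pos (\<pi> l)"

definition in_block :: "'l \<Rightarrow> bool" where
  "in_block l \<longleftrightarrow> \<pi> l \<noteq> 1"

lemma in_blockD: "in_block l \<Longrightarrow> \<pi> l = node_pos (node l)"
  unfolding in_block_def node_def using range_\<pi>[of l] inj_node_pos by (auto simp: inv_f_f)

lemma \<pi>_eq_node_pos: "\<pi> l = node_pos w \<longleftrightarrow> in_block l \<and> node l = w"
  using in_blockD[of l] node_pos_less_one[of w] inj_node_pos by (auto simp: in_block_def node_def)

lemma in_block_f: "in_block (f w q)" and node_f: "node (f w q) = w"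
  using \<pi>_f \<pi>_eq_node_pos by blast+

text \<open>The rational number \<open>0\<close> is reserved for the marked point of a block; the unit intervals
  with integer end points accommodate the copies of the blocks of smaller nodes, on either
  side of the marked point.\<close>

definition marked :: "nat list \<Rightarrow> 'l" where
  "marked w = f w 0"

text \<open>\<open>\<iota>\<close> adds a number strictly between 0 and 1, so the slot
  \<open>- 1 - n\<close> covers the interval from \<open>- 1 - n\<close> to \<open>- n\<close>,
  which stays on the left of 0 even for \<open>n = 0\<close>.\<close>

definition slot :: "bool \<Rightarrow> nat list \<Rightarrow> int" where
  "slot b v = (if b then 1 + int (to_nat v) else - 1 - int (to_nat v))"

definition place :: "bool \<Rightarrow> nat list \<Rightarrow> 'l \<Rightarrow> 'l" where
  "place b w l = f w (of_int (slot b (node l)) + \<iota> l)"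

definition copy_of :: "'l \<Rightarrow> 'l \<Rightarrow> bool" where
  "copy_of l0 l \<longleftrightarrow> in_block l0 \<and> in_block l \<and> below (node l0) (node l) \<and> (\<exists>b. l = place b (node l) l0)"

lemma node_marked: "node (marked w) = w" and in_block_marked: "in_block (marked w)"
  unfolding marked_def by (rule node_f in_block_f)+

lemma node_place: "node (place b w l) = w" and in_block_place: "in_block (place b w l)"
  unfolding place_def by (rule node_f in_block_f)+

lemma f_eq_iff: "f w q = f w q' \<longleftrightarrow> q = q'"
  using strict_mono_eq[OF strict_mono_f] .

lemma f_less_iff: "f w q < f w q' \<longleftrightarrow> q < q'"
  using strict_mono_less[OF strict_mono_f] .

lemma slot_plus_eq:
  assumes "of_int i + \<iota> l = of_int j + \<iota> l'" shows "i = j \<and> l = l'"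
proof -
  have "of_int (i - j) < (1::rat)" "of_int (j - i) < (1::rat)"
    using assms \<iota>_bounds[of l] \<iota>_bounds[of l'] by auto
  then have "i = j" by linarith
  then show ?thesis using assms strict_mono_eq[OF strict_mono_\<iota>] by simp
qed

lemma slot_plus_nonzero: "of_int i + \<iota> l \<noteq> 0"
proof
  assume "of_int i + \<iota> l = 0"
  then have "of_int i < (0::rat)" "of_int (-1) < (of_int i::rat)" using \<iota>_bounds[of l] by simp_all
  then show False unfolding of_int_less_iff by simp
qed

lemma place_True_pos: "marked w < place True w l"
  unfolding marked_def place_def f_less_iff slot_def using \<iota>_bounds[of l] by (simp add: add_pos_pos algebra_simps)

lemma place_False_neg: "place False w l < marked w"
  unfolding marked_def place_def f_less_iff slot_def using \<iota>_bounds[of l] by (simp add: add_pos_pos algebra_simps)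

lemma place_ne_marked: "place b w l \<noteq> marked w'"
proof
  assume *: "place b w l = marked w'"
  then have "w = w'" using node_place node_marked by metis
  then show False using * slot_plus_nonzero unfolding place_def marked_def by (auto simp: f_eq_iff)
qed

lemma place_less: "node l = node l' \<Longrightarrow> l < l' \<Longrightarrow> place b w l < place b w l'"
  unfolding place_def f_less_iff using strict_mono_\<iota> by (simp add: strict_mono_def)

text \<open>The integer part of the position determines the slot, the fractional part determines the
  point.\<close>

lemma copy_of_unique:
  assumes "copy_of l0 l" "copy_of l1 l" shows "l0 = l1"
proof -
  obtain b c where "l = place b (node l) l0" "l = place c (node l) l1"
    using assms unfolding copy_of_def by blast
  then have "of_int (slot b (node l0)) + \<iota> l0 = of_int (slot c (node l1)) + \<iota> l1"
    unfolding place_def using f_eq_iff by metis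
  then show ?thesis using slot_plus_eq by blast
qed

lemma copy_of_place: "in_block l \<Longrightarrow> below (node l) w \<Longrightarrow> copy_of l (place b w l)"
  unfolding copy_of_def by (auto simp: in_block_place node_place)

lemma not_copy_of_marked: "\<not> copy_of l (marked w)"
  unfolding copy_of_def using place_ne_marked by metis

lemma copy_of_sum_list: "copy_of l0 l \<Longrightarrow> sum_list (node l0) < sum_list (node l)"
  unfolding copy_of_def using below_sum_list by blast

text \<open>All copies of a point receive its colour. A block contains copies of finitely many
  smaller blocks only, which makes the colour classes reversely well-ordered and the colouring rigid.\<close>

function origin :: "'l \<Rightarrow> 'l" where
  "origin l = (if \<exists>l0. copy_of l0 l then origin (SOME l0. copy_of l0 l) else l)"
  by auto
termination
proof (relation "inv_image less_than (\<lambda>l. sum_list (node l))")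
  fix l assume "\<exists>l0. copy_of l0 l"
  then have "copy_of (SOME l0. copy_of l0 l) l" by (rule someI_ex)
  then show "(SOME l0. copy_of l0 l, l) \<in> inv_image less_than (\<lambda>l. sum_list (node l))"
    using copy_of_sum_list by simp
qed simp

declare origin.simps [simp del]

lemma origin_copy: "copy_of l0 l \<Longrightarrow> origin l = origin l0"
  using copy_of_unique origin.simps[of l] by (metis someI_ex)

lemma origin_self: "(\<And>l0. \<not> copy_of l0 l) \<Longrightarrow> origin l = l"
  by (simp add: origin.simps[of l])

lemma origin_induct [case_names copy self]:
  assumes "\<And>l0 l. copy_of l0 l \<Longrightarrow> P l0 \<Longrightarrow> P l" "\<And>l. (\<And>l0. \<not> copy_of l0 l) \<Longrightarrow> P l"
  shows "P l"
proof (induction "sum_list (node l)" arbitrary: l rule: less_induct)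
  case less
  show ?case
  proof (cases "\<exists>l0. copy_of l0 l")
    case True
    then obtain l0 where l0: "copy_of l0 l" by blast
    then show ?thesis using assms(1)[OF l0] less copy_of_sum_list by blast
  qed (use assms(2) in blast)
qed

lemma origin_in_block: "in_block (origin l) \<longleftrightarrow> in_block l"
proof (induction l rule: origin_induct)
  case (copy l0 l)
  then show ?case using origin_copy[OF copy(1)] unfolding copy_of_def by metis
qed (simp add: origin_self)

lemma origin_parity: "in_block l \<Longrightarrow> parity (node (origin l)) = parity (node l)"
proof (induction l rule: origin_induct)
  case (copy l0 l)
  then show ?case using origin_copy[OF copy(1)] below_parity unfolding copy_of_def by metis
qed (simp add: origin_self)

text \<open>Marked points show only the parities of their nodes, so an embedding may change witness
  digits but has to keep the encoded prefix of a point of the Cantor space. Any other origin has a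
  colour of its own.\<close>

definition base_colour :: "'l \<Rightarrow> nat" where
  "base_colour l = to_nat (if origin l = marked (node (origin l)) then Inl (parity (node (origin l))) else Inr (origin l) :: nat list + 'l)"

lemma base_colour_copy: "copy_of l0 l \<Longrightarrow> base_colour l = base_colour l0"
  unfolding base_colour_def by (simp add: origin_copy)

lemma base_colour_place: "in_block l \<Longrightarrow> below (node l) w \<Longrightarrow> base_colour (place b w l) = base_colour l"
  using base_colour_copy copy_of_place by blast

lemma origin_marked: "origin (marked w) = marked w"
  using not_copy_of_marked by (rule origin_self)

lemma base_colour_marked: "base_colour (marked w) = base_colour (marked w') \<longleftrightarrow> parity w = parity w'"
  unfolding base_colour_def origin_marked node_marked by simp

text \<open>Points outside the blocks take no part in copying, so they are alone in their classes.
  Within blocks a class has a single parity word, hence nodes of a single length.\<close>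

lemma base_colour_eqD:
  assumes "base_colour l = base_colour l'"
  shows "l = l' \<or> in_block l \<and> in_block l' \<and> parity (node l) = parity (node l')"
proof (cases "origin l = origin l'")
  case True
  show ?thesis
  proof (cases "in_block l")
    case True
    then show ?thesis using \<open>origin l = origin l'\<close> origin_in_block origin_parity by metis
  next
    case False
    then have "\<not> in_block l'" using origin_in_block \<open>origin l = origin l'\<close> by metis
    then have "\<not> copy_of l0 l" "\<not> copy_of l0 l'" for l0 using False unfolding copy_of_def by blast+
    then have "origin l = l" "origin l' = l'" using origin_self by metis+
    then show ?thesis using \<open>origin l = origin l'\<close> by metis
  qed
next
  case False
  then have "origin l = marked (node (origin l))" "origin l' = marked (node (origin l'))"
    "parity (node (origin l)) = parity (node (origin l'))"
    using assms unfolding base_colour_def by (auto split: if_splits)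
  then show ?thesis using origin_in_block in_block_marked origin_parity by metis
qed

text \<open>A block has at most two points of a given colour that are not copies, namely its marked
  point and one point with a private colour; the copies come from finitely many blocks with smaller
  digit sum.\<close>

lemma finite_base_colour_block: "finite {l. in_block l \<and> node l = w \<and> base_colour l = k}"
proof (induction "sum_list w" arbitrary: w rule: less_induct)
  case less
  let ?B = "\<lambda>w. {l. in_block l \<and> node l = w \<and> base_colour l = k}"
  have "?B w \<subseteq> {marked w} \<union> {l. k = to_nat (Inr l :: nat list + 'l)} \<union>
      (\<Union>v \<in> {v. below v w}. \<Union>b. place b w ` ?B v)"
  proof
    fix l assume l: "l \<in> ?B w"
    show "l \<in> {marked w} \<union> {l. k = to_nat (Inr l :: nat list + 'l)} \<union> (\<Union>v \<in> {v. below v w}. \<Union>b. place b w ` ?B v)"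
    proof (cases "\<exists>l0. copy_of l0 l")
      case True
      then obtain l0 b where l0: "copy_of l0 l" "l = place b (node l) l0" unfolding copy_of_def by blast
      have "base_colour l0 = k" using base_colour_copy[OF l0(1)] l by simp
      moreover have "in_block l0" "below (node l0) w" using l0(1) l unfolding copy_of_def by auto
      moreover have "l = place b w l0" using l0(2) l by simp
      ultimately show ?thesis by blast
    next
      case False
      then have "origin l = l" using origin_self by blast
      then show ?thesis using l unfolding base_colour_def by (auto split: if_splits)
    qed
  qed
  moreover have "finite {l. k = to_nat (Inr l :: nat list + 'l)}"
    by (rule finite_subset[of _ "{THE l. k = to_nat (Inr l :: nat list + 'l)}"]) auto
  moreover have "finite (\<Union>v \<in> {v. below v w}. \<Union>b. place b w ` ?B v)"
    using less finite_below below_sum_list by (intro finite_UN_I) auto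
  ultimately show ?case using finite_subset by blast
qed

text \<open>Going up inside a class either raises the node, all nodes of the class having equal
  length, or stays in a block, where the finite number of points of the class still above
  decreases.\<close>

lemma wf_base_colour: "wf {(l', l). base_colour l' = base_colour l \<and> l < l'}"
proof -
  define m where "m l = (node l, card {k. in_block k \<and> node k = node l \<and> base_colour k = base_colour l \<and> l < k})" for l
  have "{(l', l). base_colour l' = base_colour l \<and> l < l'} \<subseteq> inv_image (lenlex less_than <*lex*> less_than) m"
  proof clarify
    fix l' l assume c: "base_colour l' = base_colour l" and l: "l < l'"
    have in': "in_block l" "in_block l'" and len: "length (node l) = length (node l')"
      using base_colour_eqD[OF c] l length_parity by (auto, metis length_parity)
    have "node_pos (node l) \<le> node_pos (node l')" using l mono_\<pi> in' in_blockD by (metis less_imp_le monoD)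
    then consider "node_pos (node l) < node_pos (node l')" | "node l = node l'"
      using inj_node_pos by (metis injD order_le_imp_less_or_eq)
    then show "(l', l) \<in> inv_image (lenlex less_than <*lex*> less_than) m"
    proof cases
      case 1
      then show ?thesis using lenlex_of_node_pos_less[OF len] by (simp add: m_def)
    next
      case 2
      have "finite {k. in_block k \<and> node k = node l \<and> base_colour k = base_colour l \<and> l < k}"
        by (rule finite_subset[OF _ finite_base_colour_block[of "node l" "base_colour l"]]) auto
      then have "card {k. in_block k \<and> node k = node l' \<and> base_colour k = base_colour l' \<and> l' < k}
        < card {k. in_block k \<and> node k = node l \<and> base_colour k = base_colour l \<and> l < k}"
        using l c 2 in' by (intro psubset_card_mono) auto
      then show ?thesis using 2 by (simp add: m_def)
    qed
  qed
  then show ?thesis by (rule wf_subset[rotated]) (intro wf_inv_image wf_lex_prod wf_lenlex wf_less_than)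
qed

text \<open>Copies of marked points have bit 0. A marked point outside \<open>P\<close> can
  therefore be sent to one of its copies, whereas one in \<open>P\<close> has to go to a marked
  point in \<open>P'\<close>.\<close>

definition colouring :: "nat list set \<Rightarrow> 'l \<Rightarrow> nat" where
  "colouring P l = 2 * base_colour l + (if \<exists>w \<in> P. l = marked w then 1 else 0)"

lemma colouring_div: "colouring P l div 2 = base_colour l"
  by (simp add: colouring_def)

lemma odd_colouring: "odd (colouring P l) \<longleftrightarrow> (\<exists>w \<in> P. l = marked w)"
  by (simp add: colouring_def)

lemma marked_eq_iff: "marked w = marked w' \<longleftrightarrow> w = w'"
  using node_marked by metis

lemma colouring_eqI:
  assumes "base_colour l = base_colour l'" "(\<exists>w \<in> P. l = marked w) \<longleftrightarrow> (\<exists>w \<in> P'. l' = marked w)"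
  shows "colouring P l = colouring P' l'"
  using assms by (simp add: colouring_def)

text \<open>Each block is moved into the block of the shifted node, points left of the marked point
  into left slots and points right of it into right slots. The root is its own shift and has no room
  for a copy of itself; its block stays fixed, hence the condition on \<open>[]\<close>.\<close>

lemma colouring_embed:
  assumes Nil: "[] \<in> P \<longleftrightarrow> [] \<in> P'" and \<beta>: "\<And>i. 0 < \<beta> i" and PP': "\<And>w. w \<in> P \<Longrightarrow> shift \<beta> w \<in> P'"
  shows "\<exists>g. strict_mono g \<and> (\<forall>l. colouring P l = colouring P' (g l))"
proof -
  \<comment> \<open>If the node is not in \<open>P\<close>, its marked point has bit 0 and needs no
    special target, and the whole block goes to a right slot.\<close>
  define g where "g l = (if \<not> in_block l \<or> node l = [] then l
     else if node l \<notin> P \<or> marked (node l) < l then place True (shift \<beta> (node l)) l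
     else if l = marked (node l) then marked (shift \<beta> (node l))
     else place False (shift \<beta> (node l)) l)" for l
  have in_block_g: "in_block (g l) \<longleftrightarrow> in_block l" for l
    unfolding g_def by (auto simp: in_block_place in_block_marked)
  have node_g: "node (g l) = shift \<beta> (node l)" if "in_block l" for l
    using that unfolding g_def by (auto simp: node_place node_marked)
  have "strict_mono g"
  proof (rule strict_monoI)
    fix l l' :: 'l assume l: "l < l'"
    consider "\<not> in_block l'" | "in_block l'" "\<not> in_block l" | "in_block l" "in_block l'" "node l \<noteq> node l'" | "in_block l" "in_block l'" "node l = node l'"
      by blast
    then show "g l < g l'"
    proof cases
      case 1
      show ?thesis
      proof (cases "in_block l")
        case True
        then have "\<pi> (g l) < 1" using in_block_g in_blockD node_pos_less_one by metis
        moreover have "\<pi> (g l') = 1" using 1 in_block_g in_block_def by metis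
        ultimately show ?thesis using mono_\<pi> by (metis monoD linorder_not_le)
      next
        case False then show ?thesis using 1 l unfolding g_def by simp
      qed
    next
      case 2
      then have "\<pi> l' < \<pi> l" using in_blockD node_pos_less_one in_block_def by metis
      then show ?thesis using mono_\<pi> l by (metis less_imp_le monoD linorder_not_le)
    next
      case 3
      have "node_pos (node l) \<le> node_pos (node l')" using l mono_\<pi> 3 in_blockD by (metis less_imp_le monoD)
      then have "node_pos (node l) < node_pos (node l')"
        using inj_node_pos 3(3) by (metis injD order_le_imp_less_or_eq)
      then have "node_pos (node (g l)) < node_pos (node (g l'))" using node_pos_shift_less node_g 3 by metis
      then have "\<pi> (g l) < \<pi> (g l')" using in_block_g in_blockD 3 by metis
      then show ?thesis using mono_\<pi> by (metis monoD linorder_not_le)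
    next
      case 4
      have "place False w k < place True w k'" for w k k'
        using place_False_neg place_True_pos less_trans by blast
      then show ?thesis using 4 l unfolding g_def
        by (auto simp: place_less place_True_pos place_False_neg)
    qed
  qed
  moreover have "colouring P l = colouring P' (g l)" for l
  proof (rule colouring_eqI)
    consider "\<not> in_block l \<or> node l = []" | "in_block l" "node l \<noteq> []" by blast
    then have "base_colour l = base_colour (g l) \<and> ((\<exists>w \<in> P. l = marked w) \<longleftrightarrow> (\<exists>w \<in> P'. g l = marked w))"
    proof cases
      case 1
      then have "g l = l" unfolding g_def by auto
      then show ?thesis using 1 Nil by (auto simp: in_block_marked node_marked)
    next
      case 2
      have b: "below (node l) (shift \<beta> (node l))" using below_shift 2 \<beta> by blast
      show ?thesis
      proof (cases "node l \<in> P \<and> l = marked (node l)")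
        case True
        then have "g l = marked (shift \<beta> (node l))" using 2 unfolding g_def by auto
        then show ?thesis using True PP' base_colour_marked parity_shift by metis
      next
        case False
        then have "\<exists>c. g l = place c (shift \<beta> (node l)) l" using 2 unfolding g_def by (auto split: if_splits)
        then obtain c where "g l = place c (shift \<beta> (node l)) l" ..
        then show ?thesis using False base_colour_place[OF 2(1) b] place_ne_marked node_marked by metis
      qed
    qed
    then show "base_colour l = base_colour (g l)" "(\<exists>w \<in> P. l = marked w) \<longleftrightarrow> (\<exists>w \<in> P'. g l = marked w)" by blast+
  qed
  ultimately show ?thesis by blast
qed

lemma marked_of_colouring_embed:
  assumes "\<And>l. colouring P l = colouring P' (g l)" "w \<in> P"
  shows "\<exists>w' \<in> P'. g (marked w) = marked w' \<and> parity w' = parity w"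
proof -
  have "odd (colouring P' (g (marked w)))" using assms odd_colouring by metis
  then obtain w' where w': "w' \<in> P'" "g (marked w) = marked w'" unfolding odd_colouring by blast
  have "base_colour (marked w) = base_colour (marked w')" using assms(1) w'(2) colouring_div by metis
  then show ?thesis using w' base_colour_marked by metis
qed

lemma marked_less:
  assumes "node_pos w < node_pos w'" shows "marked w < marked w'"
proof -
  have "\<pi> (marked w) < \<pi> (marked w')" using assms by (simp add: marked_def \<pi>_f)
  then show ?thesis using mono_\<pi> by (metis monoD linorder_not_le)
qed

lemma node_pos_le_of_marked_less: "marked w < marked w' \<Longrightarrow> node_pos w \<le> node_pos w'"
  using mono_\<pi> unfolding marked_def by (metis \<pi>_f less_imp_le monoD)

end

section \<open>The reduction and its saturation\<close>

definition digits :: "nat list \<Rightarrow> nat \<Rightarrow> nat" where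
  "digits w i = (if i < length w then w ! i div 2 else 0)"

text \<open>The digit \<open>2 * s + u\<close> of a node stands for the pair of a digit \<open>s\<close> of a witness and a digit \<open>u\<close> of a
  point of the Cantor space.\<close>

definition code_set :: "((nat \<Rightarrow> nat) \<times> (nat \<Rightarrow> nat) \<times> (nat \<Rightarrow> nat)) set \<Rightarrow> (nat \<Rightarrow> nat) \<Rightarrow> nat list set" where
  "code_set F a = {w. w = [] \<or> (\<exists>a'. (a', a) \<in> chain_approx F (length w) (digits w) \<and> (\<forall>i<length w. a' i = w ! i mod 2))}"

lemma Nil_in_code_set: "[] \<in> code_set F a"
  by (simp add: code_set_def)

text \<open>The chain for \<open>w\<close> is followed by the step from \<open>a\<close> to
  \<open>b\<close>. The witness contributes \<open>f i + 1\<close>, because its bound is strict, and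
  composition one more at digit 0; the same 2 is used at every place.\<close>

lemma code_set_shift:
  assumes F: "(a, b, f) \<in> F" "a \<in> cantor" "b \<in> cantor" and w: "w \<in> code_set F a"
  shows "shift (\<lambda>i. f i + 2) w \<in> code_set F b"
proof (cases "w = []")
  case False
  let ?v = "shift (\<lambda>i. f i + 2) w"
  obtain a' where a': "(a', a) \<in> chain_approx F (length w) (digits w)" "\<forall>i<length w. a' i = w ! i mod 2"
    using w False unfolding code_set_def by blast
  have d: "digits ?v i = digits w i + f i + 2" if "i < length w" for i
    using that by (simp add: digits_def nth_shift)
  have "(a', b) \<in> chain_approx F (length w) (digits ?v)"
    by (rule chain_approx_compose[OF a'(1) chain_approx_witness[OF F]]) (use False d in auto)
  moreover have "\<forall>i<length w. a' i = ?v ! i mod 2" using a'(2) by (simp add: nth_shift)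
  ultimately show ?thesis unfolding code_set_def by auto
qed (simp add: Nil_in_code_set)

text \<open>Binary digits have zero witness part, so only trivial steps remain. These nodes allow
  \<open>a\<close> to be read off from its code set and form the branch that embeddings
  transport.\<close>

lemma binary_in_code_set_iff:
  assumes "a \<in> cantor" "w \<noteq> []" "\<And>i. i < length w \<Longrightarrow> w ! i < 2"
  shows "w \<in> code_set F a \<longleftrightarrow> (\<forall>i<length w. a i = w ! i)"
proof -
  have "digits w 0 = 0" using assms(2,3) by (simp add: digits_def)
  then have "chain_approx F (length w) (digits w) = agree (length w)"
    using assms(2) by (intro chain_approx_zero) auto
  then have "w \<in> code_set F a \<longleftrightarrow> (\<exists>a'. (a', a) \<in> agree (length w) \<and> (\<forall>i<length w. a' i = w ! i))"
    using assms(2,3) by (simp add: code_set_def)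
  also have "\<dots> \<longleftrightarrow> (\<forall>i<length w. a i = w ! i)"
    using assms(1) unfolding agree_def by auto
  finally show ?thesis .
qed

lemma prefix_in_code_set:
  assumes "a \<in> cantor" shows "map a [0..<n] \<in> code_set F a"
proof (cases "n = 0")
  case False
  then show ?thesis using assms by (subst binary_in_code_set_iff) (auto simp: cantor_def)
qed (simp add: Nil_in_code_set)

lemma code_set_limit:
  assumes "closed F" "a \<in> cantor" "b \<in> cantor"
    and t: "\<And>n. t n \<in> code_set F b" "\<And>n. parity (t n) = map a [0..<n]"
    and inc: "\<And>n. node_pos (t n) < node_pos (t (Suc n))"
  shows "(a, b) \<in> (Id \<union> {(x, y). \<exists>f. (x, y, f) \<in> F})\<^sup>*"
proof -
  have len: "length (t n) = n" for n using t(2)[of n] length_parity[of "t n"] by simp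
  have par: "t n ! i mod 2 = a i" if "i < n" for n i
    using that len[of n] arg_cong[OF t(2)[of n], of "\<lambda>v. v ! i"] by (simp add: parity_def)
  obtain \<alpha> where \<alpha>: "\<And>k. \<exists>n \<ge> k. \<forall>i<k. t n ! i = \<alpha> i" using increasing_nodes_converge[OF len inc] by blast
  have "(a, b) \<in> chain_approx F k (\<lambda>i. \<alpha> i div 2)" if k: "0 < k" for k
  proof -
    \<comment> \<open>Level \<open>n\<close> is taken so late that the first \<open>k\<close> digits
      have reached their limits; the chain at level \<open>n\<close> is then weakened to level
      \<open>k\<close>.\<close>
    obtain n where n: "k \<le> n" "\<forall>i<k. t n ! i = \<alpha> i" using \<alpha> by blast
    then have "t n \<noteq> []" using k len[of n] by auto
    then obtain a' where a': "(a', b) \<in> chain_approx F n (digits (t n))" "\<forall>i<n. a' i = t n ! i mod 2"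
      using t(1)[of n] len[of n] unfolding code_set_def by auto
    have "(a', b) \<in> chain_approx F k (\<lambda>i. \<alpha> i div 2)"
      by (rule subsetD[OF chain_approx_mono a'(1)]) (use n k len[of n] in \<open>auto simp: digits_def\<close>)
    moreover have "(a, a') \<in> agree k"
      using a'(2) n(1) par chain_approx_cantor[OF a'(1)] assms(2) unfolding agree_def by auto
    ultimately show ?thesis by (rule chain_approx_left[rotated])
  qed
  then show ?thesis using chain_approx_limit[OF assms(1), of a b "\<lambda>i. \<alpha> i div 2"] relpow_imp_rtrancl by blast
qed

section \<open>Borel measurability of the code sets\<close>

lemma evaluation_measurable [measurable]:
  "(\<lambda>c :: 'i::countable \<Rightarrow> nat. c i) \<in> borel_measurable borel"
  by (rule borel_measurable_continuous_onI) (rule continuous_on_product_coordinates)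

lemma cantor_measurable: "cantor \<in> sets borel"
  unfolding cantor_def by measurable

text \<open>On the Cantor space, membership depends on the first \<open>length w\<close> digits of
  \<open>a\<close> only, so the set is a countable union of cylinders intersected with
  \<open>cantor\<close>.\<close>

lemma code_set_measurable: "{a. w \<in> code_set F a} \<in> sets borel"
proof (cases "w = []")
  case False
  let ?n = "length w"
  define U where "U = {u. \<exists>a. w \<in> code_set F a \<and> u = map a [0..<?n]}"
  have sub: "a \<in> cantor" if "w \<in> code_set F a" for a
    using that False chain_approx_cantor unfolding code_set_def by blast
  have "{a. w \<in> code_set F a} = cantor \<inter> {a. \<exists>u \<in> U. \<forall>i<?n. a i = u ! i}"
  proof (intro equalityI subsetI)
    fix a assume "a \<in> {a. w \<in> code_set F a}"
    then show "a \<in> cantor \<inter> {a. \<exists>u \<in> U. \<forall>i<?n. a i = u ! i}"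
      using sub unfolding U_def by (auto intro!: exI[of _ a])
  next
    fix a assume "a \<in> cantor \<inter> {a. \<exists>u \<in> U. \<forall>i<?n. a i = u ! i}"
    then obtain b where b: "w \<in> code_set F b" "\<forall>i<?n. a i = b i" and a: "a \<in> cantor" unfolding U_def by auto
    then have "(b, a) \<in> agree ?n" using sub unfolding agree_def by auto
    then show "a \<in> {a. w \<in> code_set F a}" using b(1) chain_approx_right unfolding code_set_def by blast
  qed
  moreover have "{a :: nat \<Rightarrow> nat. \<exists>u \<in> U. \<forall>i<?n. a i = u ! i} = (\<Union>u \<in> U. {a. \<forall>i<?n. a i = u ! i})" by auto
  moreover have "{a :: nat \<Rightarrow> nat. \<forall>i<?n. a i = u ! i} \<in> sets borel" for u by measurable
  ultimately show ?thesis using cantor_measurable by (auto intro!: sets.Int sets.countable_UN'')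
qed (simp add: Nil_in_code_set)

lemma evaluation_measurable_count_space [measurable]:
  "(\<lambda>c :: 'i::countable \<Rightarrow> nat. c i) \<in> measurable borel (count_space UNIV)"
  using evaluation_measurable[of i] by (simp add: measurable_cong_sets[OF refl sets_borel_eq_count_space])

context fibred_order
begin

lemma colouring_embed_of_witness:
  assumes "(a, b, s) \<in> F" "a \<in> cantor" "b \<in> cantor"
  shows "(colouring (code_set F a), colouring (code_set F b)) \<in> col_embed"
  using colouring_embed[of "code_set F a" "code_set F b" "\<lambda>i. s i + 2"] code_set_shift[OF assms]
  unfolding col_embed_def by (simp add: Nil_in_code_set)

text \<open>The marked points at the prefixes of \<open>a\<close> form an increasing sequence. The
  embedding sends them to marked points of \<open>code_set F b\<close> with the same parities, hence
  to an increasing branch over \<open>a\<close>.\<close>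

lemma witness_of_colouring_embed:
  assumes "closed F" "a \<in> cantor" "b \<in> cantor"
    and "(colouring (code_set F a), colouring (code_set F b)) \<in> col_embed"
  shows "(a, b) \<in> (Id \<union> {(x, y). \<exists>f. (x, y, f) \<in> F})\<^sup>*"
proof -
  obtain g where g: "strict_mono g" "\<And>l. colouring (code_set F a) l = colouring (code_set F b) (g l)"
    using assms(4) unfolding col_embed_def by blast
  have "\<forall>n. \<exists>v. v \<in> code_set F b \<and> g (marked (map a [0..<n])) = marked v \<and> parity v = parity (map a [0..<n])"
    using marked_of_colouring_embed[OF g(2) prefix_in_code_set[OF assms(2)]] by blast
  then obtain t where t: "\<And>n. t n \<in> code_set F b" "\<And>n. g (marked (map a [0..<n])) = marked (t n)"
    "\<And>n. parity (t n) = parity (map a [0..<n])" by metis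
  have "parity (map a [0..<n]) = map a [0..<n]" for n
    using assms(2) by (simp add: parity_def cantor_def)
  then have par: "parity (t n) = map a [0..<n]" for n using t(3) by simp
  show ?thesis
  proof (rule code_set_limit[OF assms(1-3) t(1) par])
    fix n
    have "marked (map a [0..<n]) < marked (map a [0..<Suc n])"
      by (rule marked_less) (simp add: node_pos_less_append)
    then have "marked (t n) < marked (t (Suc n))" using g(1) t(2) by (metis strict_monoD)
    then have "node_pos (t n) \<le> node_pos (t (Suc n))" by (rule node_pos_le_of_marked_less)
    \<comment> \<open>Increasing marked points give only weakly increasing positions; the different
      lengths make them strict.\<close>
    moreover have "t n \<noteq> t (Suc n)"
      using arg_cong[OF par[of n], of length] arg_cong[OF par[of "Suc n"], of length] by auto
    ultimately show "node_pos (t n) < node_pos (t (Suc n))" using inj_node_pos by (metis injD order_le_imp_less_or_eq)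
  qed
qed

lemma colouring_code_set_measurable:
  "(\<lambda>a. colouring (code_set F a) l) \<in> borel_measurable borel"
proof -
  have [measurable]: "Measurable.pred borel (\<lambda>a. w \<in> code_set F a)" for w
    using code_set_measurable[of w F] by (simp add: pred_def)
  have "(\<lambda>a. colouring (code_set F a) l) = (\<lambda>a. 2 * base_colour l + (if \<exists>w. w \<in> code_set F a \<and> l = marked w then 1 else 0))"
    unfolding colouring_def by (intro ext) (simp add: Bex_def)
  then show ?thesis by simp
qed

text \<open>The colour classes of a colouring isomorphic to \<open>colouring P\<close> are reversely well-ordered,
  so the unique isomorphism is found by recursion from above: \<open>located c l z\<close> says that it
  maps \<open>l\<close> to \<open>z\<close>.\<close>

context notes conj_cong [fundef_cong]
begin

function located :: "('l \<Rightarrow> nat) \<Rightarrow> 'l \<Rightarrow> 'l \<Rightarrow> bool" where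
  "located c l z \<longleftrightarrow> c z div 2 = base_colour l \<and>
     (\<forall>z'. c z' div 2 = base_colour l \<longrightarrow>
        (z < z' \<longleftrightarrow> (\<exists>l'. (base_colour l' = base_colour l \<and> l < l') \<and> located c l' z')))"
  by auto
termination
  \<comment> \<open>The bracketed guard in front of the recursive call reaches the termination proof
    through the congruence rule \<open>conj_cong\<close>.\<close>
  by (relation "inv_image {(l', l). base_colour l' = base_colour l \<and> l < l'} (\<lambda>(c, l, z). l)")
    (auto intro: wf_inv_image wf_base_colour)

end

declare located.simps [simp del]

text \<open>By induction from above, the points of the class above \<open>l\<close> are located at
  their images. With \<open>z = g m\<close>, the condition then says that \<open>m\<close> and
  \<open>l\<close> have the same points of the class above them, which forces
  \<open>m = l\<close>.\<close>

lemma located_iff: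
  assumes g: "bij g" "strict_mono g" and c: "\<And>l. c (g l) div 2 = base_colour l"
  shows "located c l z \<longleftrightarrow> z = g l"
  using wf_base_colour
proof (induction l arbitrary: z rule: wf_induct_rule)
  case (less l)
  have less_g: "g k < g k' \<longleftrightarrow> k < k'" for k k' using strict_mono_less[OF g(2)] .
  obtain m where m: "z = g m" using bij_pointE[OF g(1)] by metis
  have "located c l z \<longleftrightarrow> base_colour m = base_colour l \<and>
     (\<forall>z'. c z' div 2 = base_colour l \<longrightarrow>
        (z < z' \<longleftrightarrow> (\<exists>l'. (base_colour l' = base_colour l \<and> l < l') \<and> z' = g l')))"
  proof -
    have "(base_colour l' = base_colour l \<and> l < l') \<and> located c l' z' \<longleftrightarrow> (base_colour l' = base_colour l \<and> l < l') \<and> z' = g l'" for l' z'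
      using less[of l' z'] by blast
    moreover have "c z div 2 = base_colour m" using m c by simp
    ultimately show ?thesis unfolding located.simps[of c l z] by simp
  qed
  also have "\<dots> \<longleftrightarrow> base_colour m = base_colour l \<and>
     (\<forall>k. base_colour k = base_colour l \<longrightarrow> (m < k \<longleftrightarrow> l < k))"
  proof -
    have all: "(\<forall>z'. Q z') \<longleftrightarrow> (\<forall>k. Q (g k))" for Q
    proof
      assume *: "\<forall>k. Q (g k)"
      show "\<forall>z'. Q z'"
      proof
        fix z' obtain k where "z' = g k" using bij_pointE[OF g(1)] by metis
        then show "Q z'" using * by simp
      qed
    qed simp
    have ex: "(\<exists>l'. (base_colour l' = base_colour l \<and> l < l') \<and> g k = g l') \<longleftrightarrow> base_colour k = base_colour l \<and> l < k" for k
      using bij_is_inj[OF g(1)] by (auto simp: inj_eq)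
    show ?thesis
      unfolding all[of "\<lambda>z'. c z' div 2 = base_colour l \<longrightarrow>
        (g m < z' \<longleftrightarrow> (\<exists>l'. (base_colour l' = base_colour l \<and> l < l') \<and> z' = g l'))"] ex c m less_g by blast
  qed
  also have "\<dots> \<longleftrightarrow> m = l"
  proof
    assume *: "base_colour m = base_colour l \<and> (\<forall>k. base_colour k = base_colour l \<longrightarrow> (m < k \<longleftrightarrow> l < k))"
    from * have "m < l \<longleftrightarrow> l < l" "m < m \<longleftrightarrow> l < m" by blast+
    then show "m = l" by (metis linorder_less_linear order_less_irrefl)
  qed simp
  also have "\<dots> \<longleftrightarrow> z = g l" using m bij_is_inj[OF g(1)] by (auto simp: inj_eq)
  finally show ?case .
qed

lemma located_measurable [measurable]: "Measurable.pred borel (\<lambda>c. located c l z)"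
  using wf_base_colour
proof (induction l arbitrary: z rule: wf_induct_rule)
  case (less l)
  \<comment> \<open>The guard does not depend on \<open>c\<close>: where it fails \<open>Q\<close>
    is constantly false, and where it holds the induction hypothesis applies.\<close>
  define Q where "Q c l' z' \<longleftrightarrow> (base_colour l' = base_colour l \<and> l < l') \<and> located c l' z'" for c l' z'
  have [measurable]: "Measurable.pred borel (\<lambda>c. Q c l' z')" for l' z'
    unfolding Q_def by (cases "base_colour l' = base_colour l \<and> l < l'") (use less[of l' z'] in simp_all)
  have "located c l z \<longleftrightarrow> c z div 2 = base_colour l \<and>
     (\<forall>z'. c z' div 2 = base_colour l \<longrightarrow> (z < z' \<longleftrightarrow> (\<exists>l'. Q c l' z')))" for c
    unfolding Q_def by (rule located.simps)
  then show ?case by simp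
qed

text \<open>For a colouring isomorphic to that of \<open>code_set F a\<close>, the only binary node
  of length \<open>Suc i\<close> whose marked point has an odd colour is the prefix of
  \<open>a\<close>, so its last digit is \<open>a i\<close>.\<close>

definition decode :: "('l \<Rightarrow> nat) \<Rightarrow> nat \<Rightarrow> nat" where
  "decode c i = (if \<exists>w. (length w = Suc i \<and> (\<forall>j \<le> i. w ! j < 2) \<and> w ! i = 1) \<and> (\<exists>z. located c (marked w) z \<and> odd (c z)) then 1 else 0)"

lemma decode_eq:
  assumes g: "bij g" "strict_mono g" and c: "\<And>l. c (g l) = colouring (code_set F a) l" and a: "a \<in> cantor"
  shows "decode c = a"
proof
  fix i
  have loc: "located c (marked w) z \<longleftrightarrow> z = g (marked w)" for w z
    by (rule located_iff[OF g]) (simp add: c colouring_div)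
  have "(\<exists>z. located c (marked w) z \<and> odd (c z)) \<longleftrightarrow> w \<in> code_set F a" for w
    by (simp add: loc c odd_colouring marked_eq_iff)
  then have "decode c i = (if \<exists>w. (length w = Suc i \<and> (\<forall>j \<le> i. w ! j < 2) \<and> w ! i = 1) \<and> w \<in> code_set F a then 1 else 0)"
    unfolding decode_def by simp
  moreover have "(\<exists>w. (length w = Suc i \<and> (\<forall>j \<le> i. w ! j < 2) \<and> w ! i = 1) \<and> w \<in> code_set F a) \<longleftrightarrow> a i = 1"
  proof
    assume "\<exists>w. (length w = Suc i \<and> (\<forall>j \<le> i. w ! j < 2) \<and> w ! i = 1) \<and> w \<in> code_set F a"
    then obtain w where w: "length w = Suc i" "\<forall>j \<le> i. w ! j < 2" "w ! i = 1" "w \<in> code_set F a" by blast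
    then have "w \<noteq> []" "\<And>j. j < length w \<Longrightarrow> w ! j < 2" by auto
    then show "a i = 1" using binary_in_code_set_iff[OF a, of w F] w by auto
  next
    assume "a i = 1"
    then have "(length (map a [0..<Suc i]) = Suc i \<and> (\<forall>j \<le> i. map a [0..<Suc i] ! j < 2) \<and> map a [0..<Suc i] ! i = 1)"
      using a by (simp add: cantor_def nth_append del: upt_Suc)
    then show "\<exists>w. (length w = Suc i \<and> (\<forall>j \<le> i. w ! j < 2) \<and> w ! i = 1) \<and> w \<in> code_set F a"
      using prefix_in_code_set[OF a, of "Suc i" F] by blast
  qed
  moreover have "a i = 1 \<or> a i = 0" using a unfolding cantor_def by (metis (no_types, lifting) less_2_cases mem_Collect_eq One_nat_def)
  ultimately show "decode c i = a i" by auto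
qed

lemma decode_measurable [measurable]: "decode \<in> borel_measurable borel"
  by (rule measurable_coordinatewise_then_product) (simp add: decode_def)

text \<open>Instead of asking for an isomorphism, this requires that \<open>located c\<close> is the
  graph of one. Only points of the countable order are quantified over, which keeps the set
  Borel.\<close>

definition saturation :: "((nat \<Rightarrow> nat) \<times> (nat \<Rightarrow> nat) \<times> (nat \<Rightarrow> nat)) set \<Rightarrow> (nat \<Rightarrow> nat) set \<Rightarrow> ('l \<Rightarrow> nat) set" where
  "saturation F A = {c. (\<forall>l. \<exists>z. located c l z) \<and> (\<forall>z. \<exists>l. located c l z) \<and>
     (\<forall>l l' z z'. located c l z \<longrightarrow> located c l' z' \<longrightarrow> (l < l' \<longleftrightarrow> z < z')) \<and>
     decode c \<in> A \<and> (\<forall>l z. located c l z \<longrightarrow> c z = colouring (code_set F (decode c)) l)}"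

lemma saturation_measurable:
  assumes [measurable]: "A \<in> sets borel" shows "saturation F A \<in> sets borel"
proof -
  have [measurable]: "(\<lambda>c. colouring (code_set F (decode c)) l) \<in> borel_measurable borel" for l
    using measurable_compose[OF decode_measurable colouring_code_set_measurable] .
  show ?thesis unfolding saturation_def by measurable
qed

lemma in_saturation:
  assumes "(colouring (code_set F a), c) \<in> col_iso" "a \<in> A" "a \<in> cantor"
  shows "c \<in> saturation F A" "decode c = a"
proof -
  obtain g where g: "bij g" "strict_mono g" "\<And>l. c (g l) = colouring (code_set F a) l"
    using assms(1) unfolding col_iso_def by auto
  show a: "decode c = a" using decode_eq[OF g assms(3)] .
  have loc: "located c l = (\<lambda>z. z = g l)" for l
    by (intro ext located_iff[OF g(1,2)]) (simp add: g(3) colouring_div)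
  have "\<exists>l. z = g l" for z using bij_pointE[OF g(1)] by metis
  then show "c \<in> saturation F A"
    unfolding saturation_def using assms(2) a g(3) strict_mono_less[OF g(2)] by (simp add: loc)
qed

lemma saturation_iso:
  assumes "c \<in> saturation F A"
  shows "decode c \<in> A" "(colouring (code_set F (decode c)), c) \<in> col_iso"
proof -
  have ex: "\<And>l. \<exists>z. located c l z" "\<And>z. \<exists>l. located c l z"
    and ord: "\<And>l l' z z'. located c l z \<Longrightarrow> located c l' z' \<Longrightarrow> l < l' \<longleftrightarrow> z < z'"
    and col: "\<And>l z. located c l z \<Longrightarrow> c z = colouring (code_set F (decode c)) l"
    using assms unfolding saturation_def by blast+
  show "decode c \<in> A" using assms unfolding saturation_def by blast
  obtain g where g: "\<And>l. located c l (g l)" using ex(1) by metis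
  have mono: "strict_mono g" using ord[OF g g] by (simp add: strict_mono_def)
  have "surj g"
  proof -
    have "\<exists>l. z = g l" for z
    proof -
      obtain l where "located c l z" using ex(2) by blast
      then have "z = g l" using ord[OF g[of l], of l z] ord[of l z l "g l"] g[of l] by (metis linorder_less_linear order_less_irrefl)
      then show ?thesis ..
    qed
    then show ?thesis by (simp add: surj_def)
  qed
  moreover have "inj g" using mono by (rule strict_mono_imp_inj_on)
  ultimately have "bij g" by (simp add: bij_def)
  moreover have "\<forall>l. colouring (code_set F (decode c)) l = c (g l)" using col[OF g] by metis
  ultimately show "(colouring (code_set F (decode c)), c) \<in> col_iso"
    using mono unfolding col_iso_def by blast
qed

end

section \<open>The space of colourings and its two analytic relations\<close>

lemma standard_borel_polish: "standard_borel (borel :: 'a::polish_space measure)"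
proof -
  obtain D :: "'a set" where D: "countable D" "\<And>X. open X \<Longrightarrow> X \<noteq> {} \<Longrightarrow> \<exists>d \<in> D. d \<in> X"
    using countable_dense_exists by blast
  have "closure D = UNIV"
  proof (rule ccontr)
    assume "closure D \<noteq> UNIV"
    then have "open (- closure D)" "- closure D \<noteq> {}" by auto
    then show False using D(2) closure_subset by fastforce
  qed
  then have "separable_space (euclidean :: 'a topology)"
    using D(1) unfolding separable_space_def by (intro exI[of _ D]) simp
  then show ?thesis unfolding standard_borel_def
    by (intro exI[of _ euclidean]) (simp add: completely_metrizable_space_euclidean borel_def open_openin[symmetric])
qed

lemma col_embed_trans: "(c, c') \<in> col_embed \<Longrightarrow> (c', c'') \<in> col_embed \<Longrightarrow> (c, c'') \<in> col_embed"
  unfolding col_embed_def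
  by clarify (metis (no_types, opaque_lifting) comp_apply strict_mono_o)

lemma col_iso_refl: "(c, c) \<in> col_iso"
  unfolding col_iso_def by (auto intro!: exI[of _ "\<lambda>x. x"] simp: strict_mono_def bij_id[unfolded id_def])

lemma col_embed_refl: "(c, c) \<in> col_embed"
  unfolding col_embed_def by (auto intro!: exI[of _ "\<lambda>x. x"] simp: strict_mono_def)

lemma col_iso_sym:
  assumes "(c, c') \<in> col_iso" shows "(c', c) \<in> col_iso"
proof -
  obtain h where h: "bij h" "strict_mono h" "\<And>x. c x = c' (h x)" using assms unfolding col_iso_def by blast
  have inv: "h (inv h x) = x" for x using h(1) by (simp add: bij_is_surj surj_f_inv_f)
  have "strict_mono (inv h)"
    by (rule strict_monoI) (metis h(2) inv strict_mono_less)
  moreover have "c' x = c (inv h x)" for x using h(3) inv by simp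
  ultimately show ?thesis unfolding col_iso_def using bij_imp_bij_inv[OF h(1)] by blast
qed

lemma col_iso_trans:
  assumes "(c, c') \<in> col_iso" "(c', c'') \<in> col_iso" shows "(c, c'') \<in> col_iso"
proof -
  obtain h where h: "bij h" "strict_mono h" "\<And>x. c x = c' (h x)" using assms(1) unfolding col_iso_def by blast
  obtain k where k: "bij k" "strict_mono k" "\<And>x. c' x = c'' (k x)" using assms(2) unfolding col_iso_def by blast
  have "bij (k \<circ> h)" "strict_mono (k \<circ> h)" "\<forall>x. c x = c'' ((k \<circ> h) x)"
    using h k bij_comp strict_mono_o by auto
  then show ?thesis unfolding col_iso_def by blast
qed

lemma col_iso_imp_embed: "(c, c') \<in> col_iso \<Longrightarrow> (c, c') \<in> col_embed"
  unfolding col_iso_def col_embed_def by blast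

text \<open>The map \<open>g\<close> is the witness, coded as an element of the Baire space through
  the enumeration of the order.\<close>

lemma analytic_embedding_relation:
  fixes Q :: "('l::{countable, linorder} \<Rightarrow> 'l) \<Rightarrow> bool"
  assumes Q: "Measurable.pred borel (\<lambda>f :: nat \<Rightarrow> nat. Q (\<lambda>l. from_nat (f (to_nat l))))"
  shows "analytic_set (borel \<Otimes>\<^sub>M borel) {(c, c' :: 'l \<Rightarrow> nat). \<exists>g. Q g \<and> (\<forall>x. c x = c' (g x))}"
  unfolding analytic_set_def
proof (rule bexI)
  let ?M = "(borel \<Otimes>\<^sub>M borel) \<Otimes>\<^sub>M borel :: ((('l \<Rightarrow> nat) \<times> ('l \<Rightarrow> nat)) \<times> (nat \<Rightarrow> nat)) measure"
  let ?G = "\<lambda>f l. from_nat (f (to_nat l)) :: 'l"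
  let ?B = "{p \<in> space ?M. Q (?G (snd p)) \<and> (\<forall>x. fst (fst p) x = snd (fst p) (?G (snd p) x))}"
  have [measurable]: "(\<lambda>p. fst (fst p) x) \<in> measurable ?M (count_space UNIV)" for x
    by (rule measurable_compose[OF measurable_compose[OF measurable_fst measurable_fst] evaluation_measurable_count_space])
  have [measurable]: "(\<lambda>p. snd (fst p) x) \<in> measurable ?M (count_space UNIV)" for x
    by (rule measurable_compose[OF measurable_compose[OF measurable_fst measurable_snd] evaluation_measurable_count_space])
  have [measurable]: "(\<lambda>p. snd p x) \<in> measurable ?M (count_space UNIV)" for x
    by (rule measurable_compose[OF measurable_snd evaluation_measurable_count_space])
  have [measurable]: "Measurable.pred ?M (\<lambda>p. Q (?G (snd p)))"
    using measurable_compose[OF measurable_snd Q] .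
  \<comment> \<open>The index at which \<open>snd (fst p)\<close> is evaluated depends on
    \<open>p\<close>; quantifying over its countably many values leaves evaluations at fixed
    indices.\<close>
  have eq: "(\<forall>x. fst (fst p) x = snd (fst p) (?G (snd p) x)) \<longleftrightarrow>
      (\<forall>x. \<exists>k m. snd p (to_nat x) = k \<and> fst (fst p) x = m \<and> snd (fst p) (from_nat k) = m)" for p :: "(('l \<Rightarrow> nat) \<times> ('l \<Rightarrow> nat)) \<times> (nat \<Rightarrow> nat)"
    by auto
  show "?B \<in> sets ?M" unfolding eq by measurable
  show "{(c, c'). \<exists>g. Q g \<and> (\<forall>x. c x = c' (g x))} = fst ` ?B"
  proof (intro equalityI subsetI)
    fix q :: "('l \<Rightarrow> nat) \<times> ('l \<Rightarrow> nat)" assume "q \<in> {(c, c'). \<exists>g. Q g \<and> (\<forall>x. c x = c' (g x))}"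
    then obtain c c' :: "'l \<Rightarrow> nat" and g where q: "q = (c, c')" "Q g" "\<forall>x. c x = c' (g x)" by blast
    have "(\<lambda>l. from_nat (to_nat (g (from_nat (to_nat l))))) = g" by simp
    then have "((c, c'), \<lambda>n. to_nat (g (from_nat n))) \<in> ?B" using q by (simp add: space_pair_measure)
    then show "q \<in> fst ` ?B" using q(1) by force
  qed auto
qed

lemma from_nat_measurable:
  "(\<lambda>f :: nat \<Rightarrow> nat. from_nat (f n) :: 'l::countable) \<in> measurable borel (count_space UNIV)"
  by (rule measurable_compose[OF evaluation_measurable_count_space]) simp

lemma analytic_col_embed:
  "analytic_quasi_order (borel :: ('l::{countable, linorder} \<Rightarrow> nat) measure) col_embed"
proof -
  note from_nat_measurable[where 'l = 'l, measurable]
  have "Measurable.pred borel (\<lambda>f :: nat \<Rightarrow> nat. strict_mono (\<lambda>l :: 'l. from_nat (f (to_nat l)) :: 'l))"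
    unfolding strict_mono_def by measurable
  then have "analytic_set (borel \<Otimes>\<^sub>M borel) (col_embed :: ('l \<Rightarrow> nat) rel)"
    unfolding col_embed_def by (rule analytic_embedding_relation)
  moreover have "preorder_on (space borel) (col_embed :: ('l \<Rightarrow> nat) rel)"
    using col_embed_refl col_embed_trans by (auto simp: preorder_on_def refl_on_def trans_def)
  ultimately show ?thesis unfolding analytic_quasi_order_def by blast
qed

lemma analytic_col_iso:
  "analytic_equiv (borel :: ('l::{countable, linorder} \<Rightarrow> nat) measure) col_iso"
proof -
  note from_nat_measurable[where 'l = 'l, measurable]
  have "Measurable.pred borel (\<lambda>f :: nat \<Rightarrow> nat. bij (\<lambda>l :: 'l. from_nat (f (to_nat l)) :: 'l) \<and> strict_mono (\<lambda>l :: 'l. from_nat (f (to_nat l)) :: 'l))"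
    unfolding strict_mono_def bij_def inj_def surj_def by measurable
  then have "analytic_set (borel \<Otimes>\<^sub>M borel) {(c, c' :: 'l \<Rightarrow> nat). \<exists>g :: 'l \<Rightarrow> 'l. (bij g \<and> strict_mono g) \<and> (\<forall>x. c x = c' (g x))}"
    by (rule analytic_embedding_relation[where Q = "\<lambda>g :: 'l \<Rightarrow> 'l. bij g \<and> strict_mono g"])
  then have "analytic_set (borel \<Otimes>\<^sub>M borel) (col_iso :: ('l \<Rightarrow> nat) rel)"
    unfolding col_iso_def by (simp add: conj_assoc)
  moreover have "equiv (space borel) (col_iso :: ('l \<Rightarrow> nat) rel)"
    using col_iso_refl col_iso_sym col_iso_trans by (auto intro!: equivI simp: refl_on_def sym_def trans_def)
  ultimately show ?thesis unfolding analytic_equiv_def by blast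
qed

text \<open>\<open>A\<close> is the image of \<open>\<phi>\<close>, a Borel set of fixed points. The
  Borel set of triples that witness \<open>R\<close> on \<open>A\<close> is a projection of a closed
  set, and merging the additional witness with the original one makes the relation itself the
  projection of a closed set.\<close>

lemma analytic_relation_closed_code:
  fixes N :: "'b measure"
  assumes N: "standard_borel N" and R: "analytic_set (N \<Otimes>\<^sub>M N) R"
  obtains \<phi> \<psi> A and F :: "((nat \<Rightarrow> nat) \<times> (nat \<Rightarrow> nat) \<times> (nat \<Rightarrow> nat)) set" where
    "\<phi> \<in> borel_measurable N" "A \<in> sets borel" "A \<subseteq> cantor" "\<psi> \<in> measurable (restrict_space borel A) N"
    "\<And>x. x \<in> space N \<Longrightarrow> \<phi> x \<in> A" "\<And>x. x \<in> space N \<Longrightarrow> \<psi> (\<phi> x) = x" "\<And>a. a \<in> A \<Longrightarrow> \<phi> (\<psi> a) = a"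
    "closed F" "\<And>a b. (\<exists>f. (a, b, f) \<in> F) \<longleftrightarrow> a \<in> A \<and> b \<in> A \<and> (\<psi> a, \<psi> b) \<in> R"
proof -
  obtain \<phi> :: "'b \<Rightarrow> nat \<Rightarrow> nat" and \<psi> D where \<phi>[measurable]: "\<phi> \<in> borel_measurable N"
    and bound: "\<And>x i. \<phi> x i < 2" and D[measurable]: "D \<in> sets borel" and \<psi>[measurable]: "\<psi> \<in> measurable (restrict_space borel D) N"
    and \<phi>D: "\<And>x. x \<in> space N \<Longrightarrow> \<phi> x \<in> D" and \<psi>\<phi>: "\<And>x. x \<in> space N \<Longrightarrow> \<psi> (\<phi> x) = x"
    using countable_section_standard_borel[OF N] by metis
  define A where "A = {a \<in> D. \<phi> (\<psi> a) = a}"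
  have A: "A \<in> sets borel"
  proof -
    have [measurable]: "(\<lambda>a. \<phi> (\<psi> a) i) \<in> measurable (restrict_space borel D) (count_space UNIV)" for i
      by (rule measurable_compose[OF measurable_compose[OF \<psi> \<phi>] evaluation_measurable_count_space])
    have [measurable]: "(\<lambda>a :: nat \<Rightarrow> nat. a i) \<in> measurable (restrict_space borel D) (count_space UNIV)" for i
      by (rule measurable_restrict_space1[OF evaluation_measurable_count_space])
    have "{a \<in> space (restrict_space borel D). \<forall>i. \<phi> (\<psi> a) i = a i} \<in> sets (restrict_space borel D)"
      by measurable
    moreover have "A = {a \<in> space (restrict_space borel D). \<forall>i. \<phi> (\<psi> a) i = a i}"
      unfolding A_def by (auto simp: space_restrict_space fun_eq_iff)
    ultimately show ?thesis using D by (auto simp: sets_restrict_space)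
  qed
  have \<psi>A: "\<psi> \<in> measurable (restrict_space borel A) N"
    using \<psi> by (rule measurable_restrict_mono) (auto simp: A_def)
  obtain B0 :: "(('b \<times> 'b) \<times> (nat \<Rightarrow> nat)) set" where B0: "B0 \<in> sets ((N \<Otimes>\<^sub>M N) \<Otimes>\<^sub>M borel)" "R = fst ` B0"
    using R unfolding analytic_set_def by blast
  define W :: "((nat \<Rightarrow> nat) \<times> (nat \<Rightarrow> nat) \<times> (nat \<Rightarrow> nat)) set" where "W = {p. fst p \<in> A \<and> fst (snd p) \<in> A}"
  have p1: "(fst :: (nat \<Rightarrow> nat) \<times> (nat \<Rightarrow> nat) \<times> (nat \<Rightarrow> nat) \<Rightarrow> _) \<in> measurable borel borel"
    and p2: "(\<lambda>p :: (nat \<Rightarrow> nat) \<times> (nat \<Rightarrow> nat) \<times> (nat \<Rightarrow> nat). fst (snd p)) \<in> measurable borel borel"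
    and p3: "(\<lambda>p :: (nat \<Rightarrow> nat) \<times> (nat \<Rightarrow> nat) \<times> (nat \<Rightarrow> nat). snd (snd p)) \<in> measurable borel borel"
    by (intro borel_measurable_continuous_onI continuous_intros)+
  have W: "W \<in> sets borel"
    using measurable_sets[OF p1 A] measurable_sets[OF p2 A] sets.Int
    unfolding W_def by (simp add: vimage_def Collect_conj_eq)
  define k where "k p = ((\<psi> (fst p), \<psi> (fst (snd p))), snd (snd p))" for p :: "(nat \<Rightarrow> nat) \<times> (nat \<Rightarrow> nat) \<times> (nat \<Rightarrow> nat)"
  have k: "k \<in> measurable (restrict_space borel W) ((N \<Otimes>\<^sub>M N) \<Otimes>\<^sub>M borel)"
    unfolding k_def
    by (intro measurable_Pair measurable_compose[OF _ \<psi>A] measurable_restrict_space3 p1 p2 measurable_restrict_space1[OF p3])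
      (auto simp: W_def)
  have "k -` B0 \<inter> W \<in> sets (restrict_space borel W)"
    using measurable_sets[OF k B0(1)] by (simp add: space_restrict_space)
  then have "k -` B0 \<inter> W \<in> sets borel" using W by (auto simp: sets_restrict_space)
  then have "suslin (k -` B0 \<inter> W)" by (rule suslin_borel)
  then obtain G :: "(((nat \<Rightarrow> nat) \<times> (nat \<Rightarrow> nat) \<times> (nat \<Rightarrow> nat)) \<times> (nat \<Rightarrow> nat)) set"
    where G: "closed G" "k -` B0 \<inter> W = fst ` G" unfolding suslin_def by (elim exE conjE)
  \<comment> \<open>Splits a sequence into its even and odd places, the two witnesses.\<close>
  define e where "e p = ((fst p, fst (snd p), \<lambda>n. snd (snd p) (2 * n)), \<lambda>n. snd (snd p) (2 * n + 1))"
    for p :: "(nat \<Rightarrow> nat) \<times> (nat \<Rightarrow> nat) \<times> (nat \<Rightarrow> nat)"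
  have "continuous_on UNIV e" unfolding e_def
    by (intro continuous_on_Pair continuous_on_fst continuous_on_snd continuous_on_id continuous_on_coordinatewise_then_product
        continuous_on_compose2[OF continuous_on_product_coordinates]) auto
  then have cl: "closed (e -` G)" using G(1) by (intro closed_vimage)
  have code: "(\<exists>f. (a, b, f) \<in> e -` G) \<longleftrightarrow> a \<in> A \<and> b \<in> A \<and> (\<psi> a, \<psi> b) \<in> R" for a b
  proof -
    have "(\<exists>f. (a, b, f) \<in> e -` G) \<longleftrightarrow> (\<exists>f g. ((a, b, f), g) \<in> G)"
    proof
      assume "\<exists>f g. ((a, b, f), g) \<in> G"
      then obtain f g where fg: "((a, b, f), g) \<in> G" by blast
      define h where "h n = (if even n then f (n div 2) else g (n div 2))" for n
      have "e (a, b, h) = ((a, b, f), g)" by (simp add: e_def h_def)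
      then have "(a, b, h) \<in> e -` G" using fg by simp
      then show "\<exists>f. (a, b, f) \<in> e -` G" by (rule exI[of _ h])
    qed (auto simp: e_def)
    also have "\<dots> \<longleftrightarrow> (\<exists>f. (a, b, f) \<in> k -` B0 \<inter> W)" unfolding G(2) by force
    also have "\<dots> \<longleftrightarrow> a \<in> A \<and> b \<in> A \<and> (\<exists>f. ((\<psi> a, \<psi> b), f) \<in> B0)" by (auto simp: k_def W_def)
    also have "\<dots> \<longleftrightarrow> a \<in> A \<and> b \<in> A \<and> (\<psi> a, \<psi> b) \<in> R" unfolding B0(2) by force
    finally show ?thesis .
  qed
  have "A \<subseteq> cantor"
  proof
    fix a assume "a \<in> A"
    then have "a = \<phi> (\<psi> a)" by (simp add: A_def)
    then have "a i < 2" for i using bound[of "\<psi> a" i] by simp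
    then show "a \<in> cantor" unfolding cantor_def by simp
  qed
  then show thesis
    by (rule that[OF \<phi> A _ \<psi>A _ \<psi>\<phi> _ cl code]) (use \<phi>D \<psi>\<phi> in \<open>simp_all add: A_def\<close>)
qed

context fibred_order
begin

lemma universal:
  assumes N: "standard_borel (N :: 'b measure)" and R: "analytic_quasi_order N R"
  shows "\<exists>B \<in> sets (borel :: ('l \<Rightarrow> nat) measure). col_iso `` B \<subseteq> B \<and>
    borel_bireducible N R (restrict_space borel B) (col_embed \<inter> B \<times> B)"
proof -
  have refl: "x \<in> space N \<Longrightarrow> (x, x) \<in> R" and trans: "trans R" for x
    using R unfolding analytic_quasi_order_def preorder_on_def refl_on_def by auto
  obtain \<phi> \<psi> A and F :: "((nat \<Rightarrow> nat) \<times> (nat \<Rightarrow> nat) \<times> (nat \<Rightarrow> nat)) set" where \<phi>: "\<phi> \<in> borel_measurable N" and A: "A \<in> sets borel" "A \<subseteq> cantor"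
    and \<psi>: "\<psi> \<in> measurable (restrict_space borel A) N"
    and \<phi>A: "\<And>x. x \<in> space N \<Longrightarrow> \<phi> x \<in> A" and \<psi>\<phi>: "\<And>x. x \<in> space N \<Longrightarrow> \<psi> (\<phi> x) = x"
    and \<phi>\<psi>: "\<And>a. a \<in> A \<Longrightarrow> \<phi> (\<psi> a) = a"
    and F: "closed F" "\<And>a b. (\<exists>s. (a, b, s) \<in> F) \<longleftrightarrow> a \<in> A \<and> b \<in> A \<and> (\<psi> a, \<psi> b) \<in> R"
    using analytic_relation_closed_code[OF N] R unfolding analytic_quasi_order_def by metis
  have \<psi>N: "\<psi> a \<in> space N" if "a \<in> A" for a
    using measurable_space[OF \<psi>] that by (simp add: space_restrict_space)
  define H where "H a = colouring (code_set F a)" for a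
  have embed: "(H a, H b) \<in> col_embed \<longleftrightarrow> (\<psi> a, \<psi> b) \<in> R" if a: "a \<in> A" and b: "b \<in> A" for a b
  proof
    assume "(\<psi> a, \<psi> b) \<in> R"
    then obtain s where "(a, b, s) \<in> F" using F(2) a b by blast
    then show "(H a, H b) \<in> col_embed" unfolding H_def using colouring_embed_of_witness a b A(2) by blast
  next
    assume "(H a, H b) \<in> col_embed"
    then have "(a, b) \<in> (Id \<union> {(x, y). \<exists>s. (x, y, s) \<in> F})\<^sup>*"
      unfolding H_def using witness_of_colouring_embed[OF F(1)] a b A(2) by blast
    \<comment> \<open>The closure adds nothing: \<open>R\<close> is reflexive and transitive, and
      every step of the chain stays in \<open>A\<close>.\<close>
    then have "b \<in> A \<and> (\<psi> a, \<psi> b) \<in> R"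
    proof (induction rule: rtrancl_induct)
      case base then show ?case using a refl \<psi>N by blast
    next
      case (step c d)
      then have "c = d \<or> d \<in> A \<and> (\<psi> c, \<psi> d) \<in> R" using F(2)[of c d] by auto
      then show ?case using step.IH trans by (auto dest: transD)
    qed
    then show "(\<psi> a, \<psi> b) \<in> R" ..
  qed
  define B where "B = saturation F A"
  have dec: "decode c \<in> A" "(H (decode c), c) \<in> col_iso" if "c \<in> B" for c
    using saturation_iso that unfolding B_def H_def by blast+
  have inB: "c \<in> B" if "(H a, c) \<in> col_iso" "a \<in> A" for a c
    using in_saturation(1) that A(2) unfolding B_def H_def by blast
  have Bm: "B \<in> sets borel" unfolding B_def using A(1) by (rule saturation_measurable)
  have "col_iso `` B \<subseteq> B" using inB dec col_iso_trans by blast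
  moreover have "borel_reducible N R (restrict_space borel B) (col_embed \<inter> B \<times> B)"
    unfolding borel_reducible_def
  proof (intro bexI ballI)
    fix x y assume "x \<in> space N" "y \<in> space N"
    then show "(x, y) \<in> R \<longleftrightarrow> (H (\<phi> x), H (\<phi> y)) \<in> col_embed \<inter> B \<times> B"
      using embed[OF \<phi>A \<phi>A] \<psi>\<phi> inB[OF col_iso_refl \<phi>A] by auto
  next
    have "(\<lambda>x. H (\<phi> x)) \<in> borel_measurable N"
      unfolding H_def by (intro measurable_coordinatewise_then_product measurable_compose[OF \<phi> colouring_code_set_measurable])
    then show "(\<lambda>x. H (\<phi> x)) \<in> measurable N (restrict_space borel B)"
      using inB[OF col_iso_refl \<phi>A] by (intro measurable_restrict_space2) auto
  qed
  moreover have "borel_reducible (restrict_space borel B) (col_embed \<inter> B \<times> B) N R"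
    unfolding borel_reducible_def
  proof (intro bexI ballI)
    fix c d assume "c \<in> space (restrict_space borel B)" "d \<in> space (restrict_space borel B)"
    then have c: "c \<in> B" and d: "d \<in> B" by (auto simp: space_restrict_space)
    \<comment> \<open>Members of \<open>B\<close> may be replaced by the canonical colourings of
      their decoded points, since isomorphic colourings embed into each other.\<close>
    have "(c, d) \<in> col_embed \<longleftrightarrow> (H (decode c), H (decode d)) \<in> col_embed"
      using dec(2)[OF c] dec(2)[OF d] col_iso_sym col_iso_imp_embed col_embed_trans by meson
    then show "(c, d) \<in> col_embed \<inter> B \<times> B \<longleftrightarrow> (\<psi> (decode c), \<psi> (decode d)) \<in> R"
      using embed[OF dec(1)[OF c] dec(1)[OF d]] c d by simp
  next
    have "decode \<in> measurable (restrict_space borel B) (restrict_space borel A)"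
      using decode_measurable by (rule measurable_restrict_space3) (use dec in auto)
    then show "(\<lambda>c. \<psi> (decode c)) \<in> measurable (restrict_space borel B) N"
      using \<psi> by (rule measurable_compose)
  qed
  ultimately show ?thesis unfolding borel_bireducible_def using Bm by blast
qed

end

theorem theorem5p11:
  assumes "non_scattered TYPE('l::{countable, linorder})"
  shows "invariantly_universal TYPE('b) (borel :: ('l \<Rightarrow> nat) measure) col_embed col_iso"
proof -
  \<comment> \<open>Node positions have the least value 0, taken at the root, but only the supremum
    1; adding 1 supplies the greatest value.\<close>
  have "\<exists>\<pi> :: 'l \<Rightarrow> real. mono \<pi> \<and> range \<pi> \<subseteq> insert 1 (range node_pos) \<and>
    (\<forall>v \<in> insert 1 (range node_pos). \<exists>f :: rat \<Rightarrow> 'l. strict_mono f \<and> (\<forall>q. \<pi> (f q) = v))"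
  proof (rule monotone_fibration[OF assms, where ?v0.0 = 0 and ?v1.0 = 1])
    show "0 \<in> insert 1 (range node_pos)" using node_pos.simps(1) by (metis insertI2 rangeI)
    show "0 \<le> v \<and> v \<le> 1" if "v \<in> insert 1 (range node_pos)" for v
      using that node_pos_nonneg node_pos_less_one by (auto intro: less_imp_le)
  qed auto
  then obtain \<pi> :: "'l \<Rightarrow> real" where \<pi>: "mono \<pi>" "range \<pi> \<subseteq> insert 1 (range node_pos)"
    and fib: "\<forall>v \<in> insert 1 (range node_pos). \<exists>f :: rat \<Rightarrow> 'l. strict_mono f \<and> (\<forall>q. \<pi> (f q) = v)"
    by (elim exE conjE)
  have "\<forall>w. \<exists>f :: rat \<Rightarrow> 'l. strict_mono f \<and> (\<forall>q. \<pi> (f q) = node_pos w)"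
    using fib by blast
  then obtain f :: "nat list \<Rightarrow> rat \<Rightarrow> 'l" where f: "\<And>w. strict_mono (f w)" "\<And>w q. \<pi> (f w q) = node_pos w"
    by metis
  obtain \<iota> :: "'l \<Rightarrow> rat" where \<iota>: "strict_mono \<iota>" "\<And>l. 0 < \<iota> l" "\<And>l. \<iota> l < 1"
    using countable_linorder_embeds_rat by blast
  interpret fibred_order \<pi> f \<iota>
    by unfold_locales (use \<pi> f \<iota> in blast)+
  have "col_iso \<subseteq> col_embed \<inter> (col_embed :: ('l \<Rightarrow> nat) rel)\<inverse>"
    by (rule subrelI) (simp add: col_iso_imp_embed col_iso_sym)
  then show ?thesis
    unfolding invariantly_universal_def
    using standard_borel_polish analytic_col_embed analytic_col_iso universal by blast
qed

end
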